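(* Let $0<\theta<\pi$ be given, and let $$\Delta=\{s\in\mathbb{C}:\ -\pi+\theta\le\arg(s)\le\pi-\theta,\ |s|\ge 2\pi\}.$$ Let $K\ge1$ be a natural number. For $s\in\Delta$ let $\xi,\ell,q,\mu$ and the functions $D_k$ be as defined in the context. Then for $s\in\Delta$, $s\to\infty$, we have $$\mathcal{R}(s)=\sum_{n=1}^{\ell} n^{-s}+\frac{(-1)^\ell}{2i}\,\xi^{-s}e^{\pi i\xi^2}\Bigl\{\sum_{k=0}^{K}\frac{D_k(q)}{\xi^k}+O_{K,\theta}\bigl(e^{-\frac{\pi}{2\sqrt2}|\mu|}\,|\xi|^{-K-1}\bigr)\Bigr\},$$ where the implied constant depends only on $K$ and $\theta$.
   Context: Riemann's auxiliary function is the entire function $$\mathcal{R}(s)=\int_{0\swarrow1}\frac{x^{-s}e^{\pi i x^2}}{e^{\pi i x}-e^{-\pi i x}}\,dx,$$ where the path is a straight line of direction $e^{-3\pi i/4}$ (running from the upper right to the lower left) crossing the real axis at a point strictly between $0$ and $1$, and $x^{-s}=\exp(-s\log x)$ with the principal logarithm. Throughout $\arg s$ is the principal argument. For $s\in\mathbb{C}$ with $-\pi<\arg s<\pi$ put $\xi=\sqrt{s/(2\pi i)}$, the square root being chosen with $-\frac{3\pi}{4}<\arg\xi<\frac{\pi}{4}$; $\xi_1=\operatorname{Re}\xi$, $\xi_2=\operatorname{Im}\xi$; $\ell=\lfloor\xi_1-\xi_2\rfloor\ (\ge 0)$; $q=-2(\ell+\tfrac12-\xi)$; $\mu=(\operatorname{Re}q+\operatorname{Im}q)/\sqrt2$.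 The power $\xi^{-s}=\exp(-s\log\xi)$ uses $\log\xi=\log|\xi|+i\arg\xi$ with $-\frac{3\pi}{4}<\arg\xi<\frac{\pi}{4}$. The polynomials $P_k(z)$ are defined by the power series expansion $$g(\tau,z):=\exp\Bigl\{-\frac{i}{8\tau^2}\log(1+2i\tau z)-\frac{z}{4\tau}+i\frac{z^2}{4}\Bigr\}=\sum_{k=0}^\infty P_k(z)\tau^k,\qquad 2|\tau z|<1,$$ with the principal logarithm (the singularity at $\tau=0$ is removable). For $k\ge0$ and $q\in\mathbb{C}$, $$D_k(q)=\Bigl(-\frac{1}{4\sqrt\pi}\Bigr)^k\int_{0\swarrow}\frac{e^{\frac{\pi i}{2}(v-q)^2}}{2\cos\frac{\pi v}{2}}\,P_k\bigl(i\sqrt\pi(v-q)\bigr)\,dv,$$ where the path is the straight line through the origin with direction $e^{-3\pi i/4}$. *)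

theory Defs
  imports
    "HOL-Complex_Analysis.Complex_Analysis"
    "HOL-Library.Landau_Symbols"
begin

text \<open>
  The integral of \<open>f\<close> along the full straight line through \<open>a\<close> with direction
  \<open>exp (-3 \<pi> \<i> / 4)\<close>, parametrised by arc length. The integrands below decay like
  \<open>exp (-\<pi> t\<^sup>2)\<close> respectively \<open>exp (-\<pi> t\<^sup>2 / 2)\<close> up to lower order terms in the
  exponent, so the Lebesgue integral is the right notion.
\<close>

definition line_integral :: "complex \<Rightarrow> (complex \<Rightarrow> complex) \<Rightarrow> complex" where
  "line_integral a f =
     (LBINT t. f (a + complex_of_real t * cis (- (3 * pi / 4))) * cis (- (3 * pi / 4)))"

text \<open>
  The auxiliary function of Riemann; \<open>c \<in> {0<..<1}\<close> is the point where the path crosses the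
  real axis. The value does not depend on its choice.
\<close>

definition riemann_aux :: "real \<Rightarrow> complex \<Rightarrow> complex" where
  "riemann_aux c s =
     line_integral (of_real c)
       (\<lambda>x. x powr (- s) * exp (pi * \<i> * x\<^sup>2) / (exp (pi * \<i> * x) - exp (- (pi * \<i> * x))))"

text \<open>
  \<open>csqrt\<close> would be the wrong branch here: its values have argument in \<open>(-\<pi>/2, \<pi>/2]\<close>.
  Since \<open>Arg (saddle s)\<close> lies in the range below, \<open>saddle s powr w\<close> is formed with the
  logarithm whose imaginary part lies between \<open>-3\<pi>/4\<close> and \<open>\<pi>/4\<close>.
\<close>

definition saddle :: "complex \<Rightarrow> complex" where
  "saddle s = (THE w. w\<^sup>2 = s / (2 * pi * \<i>) \<and> - (3 * pi / 4) < Arg w \<and> Arg w < pi / 4)"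

definition ell :: "complex \<Rightarrow> nat" where
  "ell s = nat \<lfloor>Re (saddle s) - Im (saddle s)\<rfloor>"

definition qq :: "complex \<Rightarrow> complex" where
  "qq s = - 2 * (of_nat (ell s) + 1 / 2 - saddle s)"

definition mu :: "complex \<Rightarrow> real" where
  "mu s = (Re (qq s) + Im (qq s)) / sqrt 2"

definition gen_fun :: "complex \<Rightarrow> complex \<Rightarrow> complex" where
  "gen_fun \<tau> z =
     exp (- (\<i> / (8 * \<tau>\<^sup>2)) * Ln (1 + 2 * \<i> * \<tau> * z) - z / (4 * \<tau>) + \<i> * z\<^sup>2 / 4)"

text \<open>
  The Taylor coefficients in \<open>\<tau>\<close> at the removable singularity \<open>\<tau> = 0\<close>; see \<open>PP_sums\<close> below.
\<close>

definition PP :: "nat \<Rightarrow> complex \<Rightarrow> complex" where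
  "PP k z = fps_nth (fps_expansion (remove_sings (\<lambda>\<tau>. gen_fun \<tau> z)) 0) k"

definition DD :: "nat \<Rightarrow> complex \<Rightarrow> complex" where
  "DD k q =
     (- (1 / (4 * sqrt pi))) ^ k *
     line_integral 0
       (\<lambda>v. exp (pi * \<i> / 2 * (v - q)\<^sup>2) / (2 * cos (pi * v / 2)) * PP k (\<i> * sqrt pi * (v - q)))"

definition sector :: "real \<Rightarrow> complex set" where
  "sector \<theta> = {s. - pi + \<theta> \<le> Arg s \<and> Arg s \<le> pi - \<theta> \<and> 2 * pi \<le> norm s}"


subsection \<open>Well-definedness\<close>

lemma saddle_eqI:
  assumes "w\<^sup>2 = s / (2 * pi * \<i>)" "- (3 * pi / 4) < Arg w" "Arg w < pi / 4"
  shows "saddle s = w"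
  unfolding saddle_def
proof (rule the_equality)
  show "w\<^sup>2 = s / (2 * pi * \<i>) \<and> - (3 * pi / 4) < Arg w \<and> Arg w < pi / 4"
    using assms by simp
next
  fix v assume v: "v\<^sup>2 = s / (2 * pi * \<i>) \<and> - (3 * pi / 4) < Arg v \<and> Arg v < pi / 4"
  show "v = w"
  proof (rule ccontr)
    assume "v \<noteq> w"
    moreover have "v\<^sup>2 = w\<^sup>2" using v assms(1) by metis
    ultimately have "v = - w" "w \<noteq> 0" by (auto simp: power2_eq_iff)
    thus False
      using v assms(2,3) Arg_minus[of w] by (auto split: if_splits)
  qed
qed

lemma saddle_correct:
  assumes "- pi < Arg s" "Arg s < pi"
  shows "(saddle s)\<^sup>2 = s / (2 * pi * \<i>)" "- (3 * pi / 4) < Arg (saddle s)"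
        "Arg (saddle s) < pi / 4"
proof -
  define w where "w = rcis (sqrt (norm s / (2 * pi))) ((Arg s - pi / 2) / 2)"
  have "w\<^sup>2 = rcis (norm s / (2 * pi)) (Arg s - pi / 2)"
    by (simp add: w_def DeMoivre2 diff_divide_distrib)
  also have "\<dots> = rcis (norm s) (Arg s) / (2 * pi * \<i>)"
    unfolding rcis_def cis_divide[symmetric] cis_pi_half by (simp add: divide_simps mult.left_commute[of \<i>])
  also have "\<dots> = s / (2 * pi * \<i>)"
    by (simp add: rcis_cmod_Arg)
  finally have 1: "w\<^sup>2 = s / (2 * pi * \<i>)" .
  have 2: "- (3 * pi / 4) < Arg w \<and> Arg w < pi / 4"
  proof (cases "s = 0")
    case False
    have "Arg w = (Arg s - pi / 2) / 2"
      unfolding w_def rcis_def using False assms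
      by (intro cis_Arg_unique) (auto simp: sgn_mult sgn_of_real)
    thus ?thesis using assms by simp
  qed (simp_all add: w_def Arg_zero)
  from saddle_eqI[OF 1] 2 have "saddle s = w" by simp
  thus "(saddle s)\<^sup>2 = s / (2 * pi * \<i>)" "- (3 * pi / 4) < Arg (saddle s)"
       "Arg (saddle s) < pi / 4"
    using 1 2 by simp_all
qed

lemma saddle_Re_minus_Im_nonneg:
  assumes "- pi < Arg s" "Arg s < pi"
  shows "0 \<le> Re (saddle s) - Im (saddle s)"
proof -
  define w where "w = saddle s"
  have "0 < cos (Arg w + pi / 4)"
    using saddle_correct[OF assms] by (intro cos_gt_zero_pi) (auto simp: w_def)
  hence "0 \<le> norm w * sqrt 2 * cos (Arg w + pi / 4)"
    by simp
  also have "\<dots> = norm w * (cos (Arg w) - sin (Arg w))"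
    by (simp add: cos_add cos_45 sin_45 algebra_simps)
  also have "\<dots> = Re w - Im w"
    using arg_cong[OF rcis_cmod_Arg[of w], of Re] arg_cong[OF rcis_cmod_Arg[of w], of Im]
    by (simp add: algebra_simps)
  finally show ?thesis by (simp add: w_def)
qed

lemma PP_sums:
  assumes "\<tau> \<noteq> 0" "2 * norm (\<tau> * z) < 1"
  shows "(\<lambda>k. PP k z * \<tau> ^ k) sums gen_fun \<tau> z"
proof -
  define f where "f = (\<lambda>\<tau>. gen_fun \<tau> z)"
  obtain r where r: "norm \<tau> < r" "2 * r * norm z < 1"
  proof (cases "z = 0")
    case True
    thus ?thesis using that[of "norm \<tau> + 1"] by simp
  next
    case False
    hence "norm \<tau> < 1 / (2 * norm z)"
      using assms by (simp add: norm_mult field_simps)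
    from dense[OF this] obtain r where "norm \<tau> < r" "r < 1 / (2 * norm z)"
      by blast
    thus ?thesis using False that[of r] by (simp add: field_simps)
  qed
  have small: "norm (2 * \<i> * w * z) < 2 * r * norm z \<or> z = 0" if "norm w < r" for w
    using that by (auto simp: norm_mult)
  have small': "norm (2 * \<i> * w * z) < 1" if "norm w < r" for w
    using small[OF that] r(2) by auto
  have nonneg: "1 + 2 * \<i> * w * z \<notin> \<real>\<^sub>\<le>\<^sub>0" if "norm w < r" for w
  proof
    assume "1 + 2 * \<i> * w * z \<in> \<real>\<^sub>\<le>\<^sub>0"
    hence "Re (2 * \<i> * w * z) \<le> -1"
      by (auto simp: complex_nonpos_Reals_iff)
    with small'[OF that] abs_Re_le_cmod[of "2 * \<i> * w * z"] show False by linarith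
  qed
  have holo: "f holomorphic_on ball 0 r - {0}"
    unfolding f_def gen_fun_def using nonneg
    by (intro holomorphic_intros) auto
  have r0: "r > 0" using r(1) norm_ge_zero[of \<tau>] by linarith
  have "\<forall>\<^sub>F w in at 0. norm (f w) \<le> exp (norm z ^ 2 / (2 * (1 - 2 * r * norm z)) + norm z ^ 2 / 4)"
  proof -
    have "\<forall>\<^sub>F w in at 0. w \<in> ball 0 r - {0}"
      using r0 by (intro eventually_at_in_open) auto
    thus ?thesis
    proof eventually_elim
      case (elim w)
      hence w: "w \<noteq> 0" "norm w < r" by auto
      define u where "u = 2 * \<i> * w * z"
      have nu: "norm u = 2 * norm w * norm z" by (simp add: u_def norm_mult)
      have "norm u \<le> 2 * r * norm z"
        using w unfolding nu by (intro mult_right_mono) auto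
      hence le: "norm (Ln (1 + u) - u) \<le> norm u ^ 2 / (1 - 2 * r * norm z)"
        using Ln_approx_linear[OF small'[OF w(2)]] r(2)
        by (fold u_def) (erule order_trans, intro divide_left_mono mult_pos_pos; simp)
      have eq: "- (\<i> / (8 * w\<^sup>2)) * Ln (1 + 2 * \<i> * w * z) - z / (4 * w) =
                - (\<i> / (8 * w\<^sup>2)) * (Ln (1 + u) - u)"
        using w(1) by (simp add: u_def field_simps power2_eq_square)
      have "norm (- (\<i> / (8 * w\<^sup>2)) * (Ln (1 + u) - u)) =
              norm (Ln (1 + u) - u) / (8 * norm w ^ 2)"
        by (simp add: norm_mult norm_divide norm_power)
      also have "\<dots> \<le> norm u ^ 2 / (1 - 2 * r * norm z) / (8 * norm w ^ 2)"
        by (intro divide_right_mono le) auto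
      also have "\<dots> = norm z ^ 2 / (2 * (1 - 2 * r * norm z))"
        using w(1) r(2) by (simp add: nu power_mult_distrib divide_simps)
      finally have A: "norm (- (\<i> / (8 * w\<^sup>2)) * (Ln (1 + u) - u)) \<le>
                         norm z ^ 2 / (2 * (1 - 2 * r * norm z))" .
      have B: "norm (\<i> * z\<^sup>2 / 4) \<le> norm z ^ 2 / 4"
        by (simp add: norm_mult norm_divide norm_power)
      have "norm (f w) \<le> exp (norm (- (\<i> / (8 * w\<^sup>2)) * (Ln (1 + u) - u) + \<i> * z\<^sup>2 / 4))"
        unfolding f_def gen_fun_def eq by (rule norm_exp)
      also have "\<dots> \<le> exp (norm z ^ 2 / (2 * (1 - 2 * r * norm z)) + norm z ^ 2 / 4)"
        using norm_triangle_mono[OF A B] by simp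
      finally show ?case .
    qed
  qed
  then obtain h where h: "h holomorphic_on ball 0 r" "\<And>w. w \<in> ball 0 r - {0} \<Longrightarrow> h w = f w"
    using holomorphic_on_extend_bounded[OF holo] r0 by auto
  have eq: "remove_sings f w = h w" if w: "w \<in> ball 0 r" for w
  proof -
    have "isCont h w"
      using holomorphic_on_imp_continuous_on[OF h(1)] w by (simp add: continuous_on_eq_continuous_at)
    moreover have "\<forall>\<^sub>F x in at w. h x = f x"
    proof -
      have "\<forall>\<^sub>F x in at w. x \<in> ball 0 r - {w}"
        using w by (intro eventually_at_in_open) auto
      moreover have "\<forall>\<^sub>F x in at w. x \<noteq> 0"
        by (rule eventually_neq_at_within)
      ultimately show ?thesis
        by eventually_elim (auto intro!: h(2))
    qed
    ultimately have "f \<midarrow>w\<rightarrow> h w"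
      unfolding isCont_def by (rule Lim_transform_eventually)
    thus ?thesis by (rule remove_sings_eqI)
  qed
  hence "remove_sings f holomorphic_on ball 0 r"
    using h(1) holomorphic_cong[of "ball 0 r" "ball 0 r" "remove_sings f" h] by simp
  from holomorphic_power_series[OF this, of \<tau>] r(1)
  have "(\<lambda>k. PP k z * \<tau> ^ k) sums remove_sings f \<tau>"
    by (simp add: PP_def fps_expansion_def f_def)
  also have "remove_sings f \<tau> = f \<tau>"
    using eq[of \<tau>] h(2)[of \<tau>] assms(1) r(1) by simp
  finally show ?thesis by (simp add: f_def)
qed

end

theory Submission
  imports Defs "HOL-Probability.Distributions" "HOL-Real_Asymp.Real_Asymp"
begin

text \<open>
  Moving the line of integration from \<open>c\<close> to \<open>ell s + 1 / 2\<close> crosses the poles \<open>1, \<dots>, ell s\<close>, whose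
  residues give the Dirichlet polynomial. With \<open>x = ell s + 1 / 2 + v / 2\<close> and \<open>x = \<xi> (1 + u)\<close> the
  remaining integrand is a constant times \<open>exp (2 \<pi> \<i> \<xi>\<^sup>2 (u + u\<^sup>2 / 2 - Ln (1 + u))) / (2 cos (\<pi> v / 2))\<close>, and
  the exponential is a Gaussian in \<open>v - q\<close> times the generating function of the \<open>P_k\<close> at
  \<open>\<tau> = - 1 / (4 sqrt \<pi> \<xi>)\<close>. Subtracting the Taylor polynomial of degree \<open>K\<close> leaves the error term. For small
  \<open>u\<close> it is bounded by Cauchy's estimates for \<open>P_k\<close>; for \<open>u\<close> bounded away from \<open>0\<close> a Gaussian bound for the
  exponential, uniform in the sector, suffices, since then \<open>1 \<le> C \<bar>u\<bar> ^ (K + 1)\<close>.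
\<close>


subsection \<open>Shifting the line of integration\<close>

text \<open>The obstacle is uniformity in \<open>Arg s\<close>. Seen from the saddle point, the path
  leaves in the relative direction \<open>cis \<phi>\<close> with
  \<open>\<phi> = pi / 4 - Arg \<xi>\<close>, which ranges over
  \<open>[\<theta> / 2, pi - \<theta> / 2]\<close>. Near the ends of this range it passes close to
  the branch point \<open>u = - 1\<close>, and the quadratic decay that is proved there degenerates
  like \<open>(sin \<phi>)^2\<close>; hence the dependence on \<theta>. The path runs through
  \<open>ell s + 1 / 2\<close> and not through \<xi>, but at bounded distance from it. The
  correction to the exponent is linear in the position on the path and is absorbed by the Gaussian.
  The radii in the Cauchy estimates come from a balance: on
  \<open>2 * norm (\<tau> * z) = 1 / 4\<close> the generating function costs
  \<open>exp (norm z ^ 2 / 4)\<close>, that is \<open>exp (pi / 4 * norm (v - q) ^ 2)\<close>, half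
  of what the Gaussian offers. The factor in \<mu> is due to the cosine: the Gaussian is centred at
  \<open>t = - \<mu>\<close>, where the reciprocal cosine has size
  \<open>exp (- pi * |\<mu>| / (2 * sqrt 2))\<close>. Residues are computed after a rotation that
  makes the lines vertical, so that rectangles serve as contours.\<close>

lemma LBINT_symmetric_intervals:
  fixes f :: "real \<Rightarrow> complex"
  assumes "integrable lborel f"
  shows "(\<lambda>n. integral {- real n..real n} f) \<longlonglongrightarrow> (LBINT x. f x)"
proof -
  have "(\<lambda>n. LBINT x. indicator {- real n..real n} x *\<^sub>R f x) \<longlonglongrightarrow> (LBINT x. f x)"
  proof (rule integral_dominated_convergence[where w = "\<lambda>x. norm (f x)"])
    show "AE x in lborel. (\<lambda>n. indicator {- real n..real n} x *\<^sub>R f x) \<longlonglongrightarrow> f x"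
    proof (rule AE_I2)
      fix x :: real
      obtain N where "\<bar>x\<bar> \<le> real N" using real_arch_simple by blast
      hence "\<forall>\<^sub>F n in sequentially. indicator {- real n..real n} x *\<^sub>R f x = f x"
        by (intro eventually_sequentiallyI[of N]) (auto simp: indicator_def)
      thus "(\<lambda>n. indicator {- real n..real n} x *\<^sub>R f x) \<longlonglongrightarrow> f x"
        by (rule tendsto_eventually)
    qed
    show "AE x in lborel. norm (indicat_real {- real n..real n} x *\<^sub>R f x) \<le> norm (f x)" for n
      by (auto simp: indicator_def)
  qed (use assms in auto)
  moreover have "(LBINT x. indicator {- real n..real n} x *\<^sub>R f x) = integral {- real n..real n} f" for n
  proof -
    have "set_integrable lborel {- real n..real n} f"
      unfolding set_integrable_def using assms by (intro integrable_mult_indicator) auto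
    from set_borel_integral_eq_integral(2)[OF this] show ?thesis
      by (simp add: set_lebesgue_integral_def)
  qed
  ultimately show ?thesis by simp
qed

text \<open>The residue theorem is applied to rectangles of growing height. Their horizontal sides
  vanish in the limit by \<open>decay\<close> and \<open>h\<close>; the vertical sides carry a
  factor \<open>\<i>\<close> that cancels against \<open>2 * pi * \<i>\<close> and leaves
  \<open>2 * pi\<close>.\<close>

lemma vertical_strip_residues:
  fixes F :: "complex \<Rightarrow> complex"
  assumes "c < d" and S: "open S" "connected S" and pts: "finite pts" "pts \<subseteq> {z. c < Re z \<and> Re z < d}"
    and strip: "{z. c \<le> Re z \<and> Re z \<le> d} \<subseteq> S"
    and holo: "F holomorphic_on S - pts"
    and int: "integrable lborel (\<lambda>x. F (Complex c x))" "integrable lborel (\<lambda>x. F (Complex d x))"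
    and decay: "\<And>z. c \<le> Re z \<Longrightarrow> Re z \<le> d \<Longrightarrow> T \<le> \<bar>Im z\<bar> \<Longrightarrow> norm (F z) \<le> h \<bar>Im z\<bar>"
    and h: "(h \<longlongrightarrow> 0) at_top"
  shows "(LBINT x. F (Complex d x)) - (LBINT x. F (Complex c x)) = 2 * pi * (\<Sum>p\<in>pts. residue F p)"
proof -
  define R where "R = (\<Sum>p\<in>pts. residue F p)"
  define bot where "bot n = contour_integral (linepath (Complex c (- real n)) (Complex d (- real n))) F" for n
  define top where "top n = contour_integral (linepath (Complex d (real n)) (Complex c (real n))) F" for n
  \<comment> \<open>Rectangles of half-height above \<open>M\<close> enclose every pole;
    \<open>insert 0\<close> keeps \<open>Max\<close> meaningful when \<open>pts\<close> is
    empty.\<close>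
  define M where "M = Max (insert 0 ((\<lambda>z. \<bar>Im z\<bar>) ` pts))"
  have M: "\<bar>Im p\<bar> \<le> M" if "p \<in> pts" for p
    unfolding M_def using pts(1) that by (intro Max_ge) auto
  have segb: "z \<in> S - pts"
    if "c \<le> Re z" "Re z \<le> d" "Re z = c \<or> Re z = d \<or> M < \<bar>Im z\<bar>" for z
    using that strip pts(2) M[of z] by auto
  have cont: "continuous_on (S - pts) F" using holo by (rule holomorphic_on_imp_continuous_on)
  have main: "bot n + \<i> * integral {- real n..real n} (\<lambda>x. F (Complex d x)) + top n
        - \<i> * integral {- real n..real n} (\<lambda>x. F (Complex c x)) = 2 * pi * \<i> * R"
    if n: "real n > M" "n > 0" for n
  proof -
    define a1 a3 where "a1 = Complex c (- real n)" and "a3 = Complex d (real n)"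
    define a2 a4 where "a2 = Complex d (- real n)" and "a4 = Complex c (real n)"
    have le: "Re a1 \<le> Re a3" "Im a1 \<le> Im a3" using assms(1) by (auto simp: a1_def a3_def)
    have sub: "path_image (rectpath a1 a3) \<subseteq> S - pts"
      unfolding path_image_rectpath[OF le] using assms(1) n
      by (intro subsetI segb) (auto simp: a1_def a3_def)
    have "contour_integral (rectpath a1 a3) F
            = 2 * pi * \<i> * (\<Sum>p\<in>pts. winding_number (rectpath a1 a3) p * residue F p)"
    proof (rule Residue_theorem[OF S pts(1) holo _ _ sub])
      show "\<forall>z. z \<notin> S \<longrightarrow> winding_number (rectpath a1 a3) z = 0"
        using strip le by (auto intro!: winding_number_rectpath_outside simp: in_cbox_complex_iff a1_def a3_def)
    qed auto
    also have "(\<Sum>p\<in>pts. winding_number (rectpath a1 a3) p * residue F p) = R"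
      unfolding R_def
    proof (rule sum.cong[OF refl])
      fix p assume "p \<in> pts"
      hence "p \<in> box a1 a3" using pts(2) M[of p] n by (auto simp: in_box_complex_iff a1_def a3_def)
      thus "winding_number (rectpath a1 a3) p * residue F p = residue F p"
        by (simp add: winding_number_rectpath)
    qed
    finally have 1: "contour_integral (rectpath a1 a3) F = 2 * pi * \<i> * R" .
    have seg: "closed_segment a1 a2 \<subseteq> S - pts" "closed_segment a2 a3 \<subseteq> S - pts"
      "closed_segment a3 a4 \<subseteq> S - pts" "closed_segment a4 a1 \<subseteq> S - pts"
      using assms(1) n
      by (intro subsetI segb; auto simp: a1_def a2_def a3_def a4_def closed_segment_same_Re
            closed_segment_same_Im closed_segment_eq_real_ivl)+
    have ci: "F contour_integrable_on linepath x y" if "closed_segment x y \<subseteq> S - pts" for x y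
      using continuous_on_subset[OF cont that] by (rule contour_integrable_continuous_linepath)
    have "contour_integral (rectpath a1 a3) F
      = contour_integral (linepath a1 a2) F + contour_integral (linepath a2 a3) F
      + contour_integral (linepath a3 a4) F + contour_integral (linepath a4 a1) F"
      unfolding rectpath_def Let_def using seg[THEN ci]
      by (simp add: a1_def a2_def a3_def a4_def)
    moreover have "contour_integral (linepath a2 a3) F = \<i> * integral {- real n..real n} (\<lambda>x. F (Complex d x))"
      using n by (intro contour_integral_linepath_same_Re) (auto simp: a2_def a3_def)
    moreover have "contour_integral (linepath a1 a4) F = \<i> * integral {- real n..real n} (\<lambda>x. F (Complex c x))"
      using n by (intro contour_integral_linepath_same_Re) (auto simp: a1_def a4_def)
    moreover have "contour_integral (linepath a4 a1) F = - contour_integral (linepath a1 a4) F"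
      using contour_integral_reversepath[of "linepath a1 a4" F] by simp
    ultimately show ?thesis using 1 unfolding bot_def top_def by (simp add: a1_def a2_def a3_def a4_def)
  qed
  have lim0: "X \<longlonglongrightarrow> 0" if X: "\<And>n. real n > max M T \<Longrightarrow> norm (X n) \<le> h (real n) * (d - c)" for X :: "nat \<Rightarrow> complex"
  proof (rule tendsto_norm_zero_cancel, rule tendsto_sandwich[OF _ _ tendsto_const])
    have "(\<lambda>n. h (real n)) \<longlonglongrightarrow> 0"
      using h filterlim_real_sequentially by (rule filterlim_compose)
    from tendsto_mult_right[OF this, of "d - c"] show "(\<lambda>n. h (real n) * (d - c)) \<longlonglongrightarrow> 0" by simp
    show "\<forall>\<^sub>F n in sequentially. norm (X n) \<le> h (real n) * (d - c)"
    proof -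
      obtain N where "max M T < real N" using reals_Archimedean2 by blast
      thus ?thesis by (intro eventually_sequentiallyI[of N] X) auto
    qed
  qed auto
  \<comment> \<open>The bound for an integral along a segment asks for a nonnegative constant;
    \<open>h\<close> has this property beyond \<open>T\<close> because it dominates a norm on the
    left edge.\<close>
  have hpos: "0 \<le> h (real n)" if "T < real n" for n
  proof -
    have "norm (F (Complex c (real n))) \<le> h \<bar>Im (Complex c (real n))\<bar>"
      using that assms(1) by (intro decay) auto
    hence "0 \<le> h \<bar>Im (Complex c (real n))\<bar>" by (rule order_trans[OF norm_ge_zero])
    thus ?thesis by simp
  qed
  have "bot \<longlonglongrightarrow> 0"
  proof (rule lim0)
    fix n assume n: "real n > max M T"
    have "norm (bot n) \<le> h (real n) * norm (Complex d (- real n) - Complex c (- real n))"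
      unfolding bot_def
    proof (rule contour_integral_bound_linepath)
      show "F contour_integrable_on linepath (Complex c (- real n)) (Complex d (- real n))"
        using n assms(1) by (intro contour_integrable_continuous_linepath continuous_on_subset[OF cont] subsetI segb)
           (auto simp: closed_segment_same_Im closed_segment_eq_real_ivl)
      fix z assume "z \<in> closed_segment (Complex c (- real n)) (Complex d (- real n))"
      hence "c \<le> Re z" "Re z \<le> d" "Im z = - real n" 
        using assms(1) by (auto simp: closed_segment_same_Im closed_segment_eq_real_ivl)
      thus "norm (F z) \<le> h (real n)" using decay[of z] n by auto
    qed (use n in \<open>auto intro!: hpos\<close>)
    also have "Complex d (- real n) - Complex c (- real n) = of_real (d - c)" by (simp add: complex_eq_iff)
    finally show "norm (bot n) \<le> h (real n) * (d - c)" using assms(1)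
      by (simp del: of_real_diff)
  qed
  moreover have "top \<longlonglongrightarrow> 0"
  proof (rule lim0)
    fix n assume n: "real n > max M T"
    have "norm (top n) \<le> h (real n) * norm (Complex c (real n) - Complex d (real n))"
      unfolding top_def
    proof (rule contour_integral_bound_linepath)
      show "F contour_integrable_on linepath (Complex d (real n)) (Complex c (real n))"
        using n assms(1) by (intro contour_integrable_continuous_linepath continuous_on_subset[OF cont] subsetI segb)
           (auto simp: closed_segment_same_Im closed_segment_eq_real_ivl)
      fix z assume "z \<in> closed_segment (Complex d (real n)) (Complex c (real n))"
      hence "c \<le> Re z" "Re z \<le> d" "Im z = real n" 
        using assms(1) by (auto simp: closed_segment_same_Im closed_segment_eq_real_ivl)
      thus "norm (F z) \<le> h (real n)" using decay[of z] n by auto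
    qed (use n in \<open>auto intro!: hpos\<close>)
    also have "Complex c (real n) - Complex d (real n) = - of_real (d - c)" by (simp add: complex_eq_iff)
    finally show "norm (top n) \<le> h (real n) * (d - c)" using assms(1)
      by (simp del: of_real_diff)
  qed
  ultimately have lim: "(\<lambda>n. bot n + \<i> * integral {- real n..real n} (\<lambda>x. F (Complex d x)) + top n
        - \<i> * integral {- real n..real n} (\<lambda>x. F (Complex c x)))
      \<longlonglongrightarrow> 0 + \<i> * (LBINT x. F (Complex d x)) + 0 - \<i> * (LBINT x. F (Complex c x))"
    by (intro tendsto_intros LBINT_symmetric_intervals int)
  obtain N where N: "M < real N" using reals_Archimedean2 by blast
  have "(\<lambda>n. bot n + \<i> * integral {- real n..real n} (\<lambda>x. F (Complex d x)) + top n
        - \<i> * integral {- real n..real n} (\<lambda>x. F (Complex c x))) \<longlonglongrightarrow> 2 * pi * \<i> * R"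
    using N by (intro tendsto_eventually eventually_sequentiallyI[of "Suc N"] main) auto
  from LIMSEQ_unique[OF lim this]
  have "\<i> * ((LBINT x. F (Complex d x)) - (LBINT x. F (Complex c x))) = \<i> * (2 * pi * R)"
    by (simp add: algebra_simps)
  thus ?thesis unfolding R_def by (simp only: mult_cancel_left complex_i_not_zero simp_thms)
qed

section \<open>Gaussian majorants and crude bounds for the factors of the integrand\<close>

lemma integrable_gauss_linear:
  fixes a b c :: real
  assumes "c > 0"
  shows "integrable lborel (\<lambda>x. exp (a + b * \<bar>x\<bar> - c * x\<^sup>2))"
proof (rule Bochner_Integration.integrable_bound)
  have "integrable lborel (\<lambda>x. exp (a + b\<^sup>2 / (2 * c)) * sqrt (2 * pi * (1 / sqrt c)\<^sup>2) * normal_density 0 (1 / sqrt c) x)"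
    using assms by (intro integrable_mult_right integrable_normal_density) auto
  also have "(\<lambda>x. exp (a + b\<^sup>2 / (2 * c)) * sqrt (2 * pi * (1 / sqrt c)\<^sup>2) * normal_density 0 (1 / sqrt c) x)
      = (\<lambda>x. exp (a + b\<^sup>2 / (2 * c) - c / 2 * x\<^sup>2))"
  proof
    fix x
    have "sqrt (2 * pi * (1 / sqrt c)\<^sup>2) * normal_density 0 (1 / sqrt c) x = exp (- (c / 2 * x\<^sup>2))"
      using assms by (simp add: normal_density_def power_divide)
    thus "exp (a + b\<^sup>2 / (2 * c)) * sqrt (2 * pi * (1 / sqrt c)\<^sup>2) * normal_density 0 (1 / sqrt c) x
        = exp (a + b\<^sup>2 / (2 * c) - c / 2 * x\<^sup>2)"
      by (simp add: mult.assoc flip: exp_add)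
  qed
  finally show "integrable lborel (\<lambda>x. exp (a + b\<^sup>2 / (2 * c) - c / 2 * x\<^sup>2))" .
  show "AE x in lborel. norm (exp (a + b * \<bar>x\<bar> - c * x\<^sup>2)) \<le> norm (exp (a + b\<^sup>2 / (2 * c) - c / 2 * x\<^sup>2))"
  proof (rule AE_I2)
    fix x :: real
    \<comment> \<open>Half of the quadratic decay pays for the linear term; the other half is a
      multiple of the normal density with variance \<open>1 / c\<close>.\<close>
    have "0 \<le> (b - c * \<bar>x\<bar>)\<^sup>2 / (2 * c)" using assms by simp
    also have "\<dots> = b\<^sup>2 / (2 * c) - b * \<bar>x\<bar> + c / 2 * x\<^sup>2"
      using assms by (simp add: power2_eq_square field_simps)
    finally show "norm (exp (a + b * \<bar>x\<bar> - c * x\<^sup>2)) \<le> norm (exp (a + b\<^sup>2 / (2 * c) - c / 2 * x\<^sup>2))"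
      by simp
  qed
qed auto

text \<open>The moduli of the two exponentials differ by \<open>2 * |sinh (Re w)|\<close>, which is
  at least \<open>|Re w|\<close>. This keeps the denominator of the integrand away from 0 off the
  real axis.\<close>

lemma norm_exp_diff_ge: "\<bar>Re w\<bar> \<le> norm (exp w - exp (- w))" for w :: complex
proof -
  have *: "\<bar>Re w\<bar> \<le> \<bar>exp (Re w) - exp (- Re w)\<bar>"
  proof (cases "Re w \<ge> 0")
    case True
    hence "exp (- Re w) \<le> 1" by simp
    thus ?thesis using True exp_ge_add_one_self[of "Re w"] by linarith
  next
    case False
    hence "exp (Re w) \<le> 1" by simp
    thus ?thesis using False exp_ge_add_one_self[of "- Re w"] by linarith
  qed
  also have "\<dots> = \<bar>norm (exp w) - norm (exp (- w))\<bar>" by simp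
  also have "\<dots> \<le> norm (exp w - exp (- w))" by (rule norm_triangle_ineq3)
  finally show ?thesis .
qed

text \<open>Crude on purpose: \<open>ln (norm x) \<le> norm x\<close>, and the argument is at most
  \<open>pi\<close> in modulus. Growth of this order is harmless next to the Gaussian
  factor.\<close>

lemma norm_powr_le:
  assumes "1 \<le> norm x"
  shows "norm (x powr (s::complex)) \<le> exp (norm s * (norm x + pi))"
proof -
  have "norm (Ln x) \<le> \<bar>Re (Ln x)\<bar> + \<bar>Im (Ln x)\<bar>" by (rule cmod_le)
  also have "\<bar>Im (Ln x)\<bar> \<le> pi" using assms mpi_less_Im_Ln[of x] Im_Ln_le_pi[of x] by fastforce
  also have "\<bar>Re (Ln x)\<bar> \<le> norm x"
    using assms ln_bound[of "norm x"] by (subst Re_Ln) force+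
  finally have "norm (Ln x) \<le> norm x + pi" by simp
  hence "norm (s * Ln x) \<le> norm s * (norm x + pi)" by (simp add: norm_mult mult_left_mono)
  moreover have "norm (x powr s) \<le> exp (norm (s * Ln x))"
    using assms norm_exp[of "s * Ln x"] by (auto simp: powr_def)
  ultimately show ?thesis by (meson exp_le_cancel_iff order_trans)
qed

section \<open>The integrand in rotated coordinates: decay, poles and residues\<close>

definition aux_integrand :: "complex \<Rightarrow> complex \<Rightarrow> complex" where
  "aux_integrand s x = x powr (- s) * exp (pi * \<i> * x\<^sup>2) / (exp (pi * \<i> * x) - exp (- (pi * \<i> * x)))"

lemma riemann_aux_eq: "riemann_aux c s = line_integral (of_real c) (aux_integrand s)"
  by (simp add: riemann_aux_def aux_integrand_def[abs_def])

text \<open>Multiplication by \<open>cis (3 * pi / 4)\<close> maps the upward vertical line through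
  \<open>- a / sqrt 2\<close> onto the line of integration through \<open>a\<close>.\<close>

definition rot_integrand :: "complex \<Rightarrow> complex \<Rightarrow> complex" where
  "rot_integrand s y = aux_integrand s (cis (3 * pi / 4) * y)"

lemma cis_135: "cis (3 * pi / 4) = Complex (- 1 / sqrt 2) (1 / sqrt 2)"
proof -
  have *: "3 * pi / 4 = pi - pi / 4" by simp
  have "cos (3 * pi / 4) = - 1 / sqrt 2" "sin (3 * pi / 4) = 1 / sqrt 2"
    unfolding * cos_pi_minus sin_pi_minus cos_45 sin_45 by (simp_all add: real_div_sqrt field_simps)
  thus ?thesis by (simp add: complex_eq_iff)
qed

lemma cis_m135: "cis (- (3 * pi / 4)) = Complex (- 1 / sqrt 2) (- 1 / sqrt 2)"
  using arg_cong[OF cis_135, of cnj] by (simp add: cis_cnj complex_eq_iff)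

lemma Re_rot: "Re (cis (3 * pi / 4) * y) = - (Re y + Im y) / sqrt 2"
  and Im_rot: "Im (cis (3 * pi / 4) * y) = (Re y - Im y) / sqrt 2"
  unfolding cis_135 by (simp_all add: field_simps)

text \<open>\<open>Re - Im\<close> is the coordinate transverse to the lines of integration: on the
  line that crosses the real axis at \<open>a\<close> it equals \<open>a\<close> throughout.\<close>

lemma Re_minus_Im_rot: "Re (cis (3 * pi / 4) * y) - Im (cis (3 * pi / 4) * y) = - (sqrt 2 * Re y)"
  unfolding Re_rot Im_rot by (simp add: field_simps)

text \<open>The factor \<open>exp (pi * \<i> * x^2)\<close> becomes \<open>exp (pi * y^2)\<close>,
  of modulus \<open>exp (pi * ((Re y)^2 - (Im y)^2))\<close>, and so decays along vertical
  lines.\<close>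

lemma rot_power2: "(cis (3 * pi / 4) * y)\<^sup>2 = - \<i> * y\<^sup>2"
  unfolding cis_135 by (simp add: complex_eq_iff power2_eq_square field_simps)

lemma rot_integrand_decay:
  assumes "c \<le> Re y" "Re y < 0" "2 - c \<le> \<bar>Im y\<bar>"
  shows "norm (rot_integrand s y) \<le> exp (norm s * (- c + pi) + pi * c\<^sup>2 + norm s * \<bar>Im y\<bar> - pi * \<bar>Im y\<bar>\<^sup>2)"
proof -
  define x where "x = cis (3 * pi / 4) * y"
  \<comment> \<open>The threshold \<open>2 - c\<close> forces \<open>|Re y - Im y| \<ge> 2\<close>,
    hence \<open>|Im x| \<ge> 1\<close>. This makes the bound for the power applicable and the
    denominator at least 1.\<close>
  hence "sqrt 2 \<le> \<bar>Re y - Im y\<bar>" using assms sqrt2_less_2 by linarith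
  hence "1 \<le> \<bar>Im x\<bar>"  unfolding x_def Im_rot by (simp add: field_simps)
  moreover have "\<bar>Im x\<bar> \<le> norm x" by (rule abs_Im_le_cmod)
  ultimately have x1: "1 \<le> norm x" by linarith
  have xy: "norm x = norm y" by (simp add: x_def norm_mult)
  have D: "1 \<le> norm (exp (pi * \<i> * x) - exp (- (pi * \<i> * x)))"
  proof -
    have "1 * 1 \<le> pi * \<bar>Im x\<bar>" using \<open>1 \<le> \<bar>Im x\<bar>\<close> pi_ge_two by (intro mult_mono) auto
    also have "\<dots> = \<bar>Re (pi * \<i> * x)\<bar>" by (simp add: abs_mult)
    also have "\<dots> \<le> norm (exp (pi * \<i> * x) - exp (- (pi * \<i> * x)))" by (rule norm_exp_diff_ge)
    finally show ?thesis by simp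
  qed
  have "norm (rot_integrand s y) = norm (x powr (-s)) * norm (exp (pi * \<i> * x\<^sup>2)) / norm (exp (pi * \<i> * x) - exp (- (pi * \<i> * x)))"
    by (simp add: rot_integrand_def aux_integrand_def x_def norm_mult norm_divide)
  also have "\<dots> \<le> norm (x powr (-s)) * norm (exp (pi * \<i> * x\<^sup>2)) / 1"
    using D by (intro divide_left_mono) auto
  also have "\<dots> \<le> exp (norm s * (norm x + pi)) * exp (pi * ((Re y)\<^sup>2 - (Im y)\<^sup>2))"
  proof -
    have "norm (x powr (-s)) \<le> exp (norm s * (norm x + pi))" using norm_powr_le[OF x1, of "-s"] by simp
    moreover have "norm (exp (pi * \<i> * x\<^sup>2)) = exp (pi * ((Re y)\<^sup>2 - (Im y)\<^sup>2))"
      unfolding x_def rot_power2 by (simp add: power2_eq_square algebra_simps)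
    ultimately show ?thesis by simp
  qed
  also have "\<dots> = exp (norm s * (norm y + pi) + pi * ((Re y)\<^sup>2 - (Im y)\<^sup>2))"
    by (simp add: exp_add xy)
  also have "\<dots> \<le> exp (norm s * (- c + pi) + pi * c\<^sup>2 + norm s * \<bar>Im y\<bar> - pi * \<bar>Im y\<bar>\<^sup>2)"
  proof -
    have "norm y \<le> - c + \<bar>Im y\<bar>" using cmod_le[of y] assms by linarith
    hence "norm s * (norm y + pi) \<le> norm s * (- c + \<bar>Im y\<bar> + pi)" by (intro mult_left_mono) auto
    moreover have "(Re y)\<^sup>2 \<le> c\<^sup>2" using assms by (intro abs_le_square_iff[THEN iffD1]) auto
    hence "pi * ((Re y)\<^sup>2 - (Im y)\<^sup>2) \<le> pi * (c\<^sup>2 - (Im y)\<^sup>2)" by (intro mult_left_mono) auto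
    moreover have "norm s * (- c + \<bar>Im y\<bar> + pi) + pi * (c\<^sup>2 - (Im y)\<^sup>2)
      = norm s * (- c + pi) + pi * c\<^sup>2 + norm s * \<bar>Im y\<bar> - pi * \<bar>Im y\<bar>\<^sup>2"
      by (simp add: algebra_simps)
    ultimately show ?thesis by (metis add_mono exp_le_cancel_iff)
  qed
  finally show ?thesis .
qed

lemma sin_denominator_eq_0_iff:
  "exp (pi * \<i> * x) - exp (- (pi * \<i> * x)) = 0 \<longleftrightarrow> x \<in> \<int>"
proof -
  have "exp (pi * \<i> * x) - exp (- (pi * \<i> * x)) = 0 \<longleftrightarrow> exp (pi * \<i> * x) * exp (pi * \<i> * x) = 1"
    by (simp add: exp_minus field_simps)
  also have "\<dots> \<longleftrightarrow> exp (2 * pi * \<i> * x) = 1"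
    by (simp add: exp_add[symmetric] mult_ac)
  also have "\<dots> \<longleftrightarrow> x \<in> \<int>"
  proof
    assume "exp (2 * pi * \<i> * x) = 1"
    then obtain n :: int where "Im x = 0" "2 * pi * Re x = of_int (2 * n) * pi"
      by (auto simp: exp_eq_1)
    hence "x = of_int n" by (simp add: complex_eq_iff)
    thus "x \<in> \<int>" by simp
  qed (auto simp: exp_eq_1 elim!: Ints_cases)
  finally show ?thesis .
qed

lemma half_plane_notin_nonpos_Reals: "Im x < Re x \<Longrightarrow> x \<notin> \<real>\<^sub>\<le>\<^sub>0"
  by (auto simp: complex_nonpos_Reals_iff)

lemma Ints_half_plane:
  assumes "x \<in> \<int>" "real m < Re x - Im x" "Re x - Im x < real n + 1"
  shows "x \<in> of_nat ` {m+1..n}"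
proof -
  from assms(1) obtain k where k: "x = of_int k" by (elim Ints_cases)
  hence "int m < k" "k < int n + 1" using assms(2,3) by auto
  thus ?thesis using k by (intro image_eqI[of _ _ "nat k"]) auto
qed

lemma holomorphic_rot_integrand_numerator:
  "(\<lambda>y. (cis (3 * pi / 4) * y) powr (- s) * exp (pi * \<i> * (cis (3 * pi / 4) * y)\<^sup>2)) holomorphic_on {y. Re y < 0}"
proof (intro holomorphic_intros)
  fix y assume "y \<in> {y. Re y < 0}"
  hence "0 < - (sqrt 2 * Re y)" by (simp add: mult_pos_neg)
  with Re_minus_Im_rot[of y] show "cis (3 * pi / 4) * y \<notin> \<real>\<^sub>\<le>\<^sub>0"
    by (intro half_plane_notin_nonpos_Reals) linarith
qed

text \<open>The vertical line corresponds to the line of integration through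
  \<open>- (sqrt 2 * c)\<close>, so the second hypothesis keeps it off the poles. The majorant is a
  Gaussian plus a constant on a compact interval.\<close>

lemma integrable_rot_integrand:
  assumes "c < 0" "- (sqrt 2 * c) \<notin> \<int>"
  shows "integrable lborel (\<lambda>x. rot_integrand s (Complex c x))"
proof -
  define h where "h = (\<lambda>x. exp (norm s * (- c + pi) + pi * c\<^sup>2 + norm s * \<bar>x\<bar> - pi * x\<^sup>2))"
  define T where "T = 2 - c"
  have D0: "exp (pi * \<i> * (cis (3 * pi / 4) * Complex c x)) - exp (- (pi * \<i> * (cis (3 * pi / 4) * Complex c x))) \<noteq> 0" for x
  proof
    assume "exp (pi * \<i> * (cis (3 * pi / 4) * Complex c x)) - exp (- (pi * \<i> * (cis (3 * pi / 4) * Complex c x))) = 0"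
    then obtain k :: int where "cis (3 * pi / 4) * Complex c x = of_int k"
      unfolding sin_denominator_eq_0_iff by (elim Ints_cases)
    with Re_minus_Im_rot[of "Complex c x"] have "- (sqrt 2 * c) = of_int k" by simp
    thus False using assms(2) by (metis Ints_of_int)
  qed
  have cont: "continuous_on UNIV (\<lambda>x. rot_integrand s (Complex c x))"
  proof -
    define D where "D = (\<lambda>y. exp (pi * \<i> * (cis (3 * pi / 4) * y)) - exp (- (pi * \<i> * (cis (3 * pi / 4) * y))))"
    have C: "continuous_on UNIV (Complex c)"
      unfolding Complex_eq[abs_def] by (intro continuous_intros)
    have "continuous_on UNIV D" unfolding D_def by (intro continuous_intros)
    from continuous_on_compose2[OF this C] have cD: "continuous_on UNIV (\<lambda>x. D (Complex c x))" by simp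
    have "range (Complex c) \<subseteq> {y. Re y < 0}" using assms(1) by auto
    from continuous_on_compose2[OF holomorphic_on_imp_continuous_on[OF holomorphic_rot_integrand_numerator] C this]
    have cN: "continuous_on UNIV (\<lambda>x. (cis (3 * pi / 4) * Complex c x) powr (- s) * exp (pi * \<i> * (cis (3 * pi / 4) * Complex c x)\<^sup>2))" .
    show ?thesis
      using continuous_on_divide[OF cN cD] D0 unfolding rot_integrand_def aux_integrand_def D_def by simp
  qed
  have "compact ((\<lambda>x. rot_integrand s (Complex c x)) ` {- T..T})"
    by (intro compact_continuous_image continuous_on_subset[OF cont]) auto
  then obtain M where M: "\<And>x. x \<in> {- T..T} \<Longrightarrow> norm (rot_integrand s (Complex c x)) \<le> M"
    using compact_imp_bounded bounded_iff by (metis imageI)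
  show ?thesis
  proof (rule Bochner_Integration.integrable_bound)
    show "integrable lborel (\<lambda>x. h x + indicator {- T..T} x * M)"
      unfolding h_def by (intro Bochner_Integration.integrable_add integrable_gauss_linear integrable_mult_left) (auto simp: integrable_indicator_iff emeasure_lborel_Icc_eq)
    show "(\<lambda>x. rot_integrand s (Complex c x)) \<in> borel_measurable lborel"
      using borel_measurable_continuous_onI[OF cont] by simp
    show "AE x in lborel. norm (rot_integrand s (Complex c x)) \<le> norm (h x + indicator {- T..T} x * M)"
    proof (rule AE_I2)
      fix x
      show "norm (rot_integrand s (Complex c x)) \<le> norm (h x + indicator {- T..T} x * M)"
      proof (cases "x \<in> {- T..T}")
        case True
        moreover have "0 \<le> h x" by (simp add: h_def)
        ultimately show ?thesis using M[of x] by simp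
      next
        case False
        hence "2 - c \<le> \<bar>x\<bar>" by (auto simp: T_def)
        thus ?thesis using rot_integrand_decay[of c "Complex c x" s] assms(1) False
          by (simp add: h_def)
      qed
    qed
  qed
qed

text \<open>As \<open>n^2\<close> and \<open>n\<close> have the same parity, the exponential in the
  numerator equals the sign \<open>e\<close>; the derivative of the denominator carries the same
  sign, and the two cancel.\<close>

lemma residue_rot_integrand:
  assumes "n > 0"
  shows "residue (rot_integrand s) (of_nat n / cis (3 * pi / 4)) = of_nat n powr (- s) / (2 * pi * \<i> * cis (3 * pi / 4))"
proof -
  define y where "y = of_nat n / cis (3 * pi / 4)"
  define f where "f = (\<lambda>y. (cis (3 * pi / 4) * y) powr (- s) * exp (pi * \<i> * (cis (3 * pi / 4) * y)\<^sup>2))"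
  define g where "g = (\<lambda>y. exp (pi * \<i> * (cis (3 * pi / 4) * y)) - exp (- (pi * \<i> * (cis (3 * pi / 4) * y))))"
  define e where "e = exp (pi * \<i> * of_nat n)"
  have ky: "cis (3 * pi / 4) * y = of_nat n" by (simp add: y_def)
  have ry: "Re y < 0"
  proof -
    have "sqrt 2 * Re y = - real n" using Re_minus_Im_rot[of y] by (simp add: ky)
    hence "sqrt 2 * Re y < 0" using assms by simp
    thus ?thesis by (simp add: mult_less_0_iff)
  qed
  have e: "e * e = 1" "e \<noteq> 0"
    unfolding e_def by (simp_all add: exp_add[symmetric] exp_eq_1, metis of_int_of_nat_eq)
  have em: "exp (- (pi * \<i> * of_nat n)) = e"
    using e unfolding e_def exp_minus by (simp add: field_simps)
  have esq: "exp (pi * \<i> * (of_nat n)\<^sup>2) = e"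
  proof -
    have "exp (pi * \<i> * (of_nat n)\<^sup>2) = e ^ n"
      unfolding e_def by (simp add: exp_of_nat_mult[symmetric] power2_eq_square mult_ac)
    also have "e ^ n = e"
    proof (cases "even n")
      case True
      then obtain k where k: "n = 2 * k" by auto
      have "e = 1" unfolding e_def k by (simp add: exp_eq_1, metis of_int_of_nat_eq)
      thus ?thesis by simp
    next
      case False
      then obtain k where "n = Suc (2 * k)" by (auto elim: oddE)
      thus ?thesis using e by (simp add: power_mult power2_eq_square)
    qed
    finally show ?thesis .
  qed
  have "residue (\<lambda>w. f w / g w) y = f y / (2 * pi * \<i> * cis (3 * pi / 4) * e)"
  proof (rule residue_simple_pole_deriv)
    show "f holomorphic_on {y. Re y < 0}" unfolding f_def by (rule holomorphic_rot_integrand_numerator)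
    show "g holomorphic_on {y. Re y < 0}" unfolding g_def by (intro holomorphic_intros)
    show "open {y. Re y < 0}" by (rule open_halfspace_Re_lt)
    show "connected {y. Re y < 0}" by (intro convex_connected convex_halfspace_Re_lt)
    show "y \<in> {y. Re y < 0}" using ry by simp
    show "f y \<noteq> 0" unfolding f_def ky using assms by simp
    show "g y = 0" unfolding g_def ky using em by (simp add: e_def)
    show "(g has_field_derivative 2 * pi * \<i> * cis (3 * pi / 4) * e) (at y)"
      unfolding g_def by (auto intro!: derivative_eq_intros simp: ky em e_def[symmetric])
    show "2 * pi * \<i> * cis (3 * pi / 4) * e \<noteq> 0" using e by simp
  qed
  moreover have "f y = of_nat n powr (- s) * e" unfolding f_def ky esq ..
  moreover have "rot_integrand s = (\<lambda>w. f w / g w)"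
    by (simp add: rot_integrand_def aux_integrand_def f_def g_def fun_eq_iff)
  ultimately show ?thesis using e by (simp add: y_def)
qed

lemma line_point_rot: "of_real a + of_real t * cis (- (3 * pi / 4)) = cis (3 * pi / 4) * Complex (- a / sqrt 2) (t - a / sqrt 2)"
  unfolding cis_135 cis_m135 by (simp add: complex_eq_iff field_simps)

lemma line_integral_rot:
  "line_integral (of_real a) (aux_integrand s) = (LBINT x. rot_integrand s (Complex (- a / sqrt 2) x)) * cis (- (3 * pi / 4))"
proof -
  have "line_integral (of_real a) (aux_integrand s)
      = (LBINT t. rot_integrand s (Complex (- a / sqrt 2) (- a / sqrt 2 + 1 * t)) * cis (- (3 * pi / 4)))"
    unfolding line_integral_def line_point_rot rot_integrand_def by simp
  also have "\<dots> = (LBINT x. rot_integrand s (Complex (- a / sqrt 2) x) * cis (- (3 * pi / 4)))"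
    by (subst lborel_integral_real_affine[where c = 1 and t = "- a / sqrt 2"]) simp_all
  also have "\<dots> = (LBINT x. rot_integrand s (Complex (- a / sqrt 2) x)) * cis (- (3 * pi / 4))" by simp
  finally show ?thesis .
qed

lemma nat_gap_notin_Ints: "real m < x \<Longrightarrow> x < real m + 1 \<Longrightarrow> x \<notin> \<int>"
proof
  assume "real m < x" "x < real m + 1" "x \<in> \<int>"
  then obtain k :: int where "x = of_int k" "real m < of_int k" "of_int k < real m + 1"
    by (auto elim: Ints_cases)
  hence "int m < k" "k < int m + 1" by linarith+
  thus False by simp
qed

lemma integrable_aux_integrand_line:
  assumes "real m < a" "a < real m + 1"
  shows "integrable lborel (\<lambda>t. aux_integrand s (of_real a + of_real t * cis (- (3 * pi / 4))))"
proof -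
  have "integrable lborel (\<lambda>x. rot_integrand s (Complex (- a / sqrt 2) x))"
    using assms nat_gap_notin_Ints[OF assms] by (intro integrable_rot_integrand) auto
  from lborel_integrable_real_affine[OF this, of 1 "- a / sqrt 2"]
  show ?thesis unfolding line_point_rot rot_integrand_def by simp
qed

text \<open>The rotation reverses the order: the line through the larger \<open>b\<close> becomes
  the left edge \<open>Re y = c\<close>. In the strip \<open>S\<close> the denominator vanishes
  exactly at the rotated integers \<open>m+1..n\<close>.\<close>

lemma line_integral_shift:
  assumes a: "real m < a" "a < real m + 1" and b: "real n < b" "b < real n + 1" and "a < b"
  shows "line_integral (of_real a) (aux_integrand s) =
    (\<Sum>k = m+1..n. of_nat k powr (- s)) + line_integral (of_real b) (aux_integrand s)"
proof -
  define c d where "c = - b / sqrt 2" and "d = - a / sqrt 2"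
  define pts where "pts = (\<lambda>k. of_nat k / cis (3 * pi / 4)) ` {m+1..n}"
  define S where "S = {y. Re y < - real m / sqrt 2} \<inter> {y. Re y > - (real n + 1) / sqrt 2}"
  define h where "h = (\<lambda>x. exp (norm s * (- c + pi) + pi * c\<^sup>2 + norm s * x - pi * x\<^sup>2))"
  have Srot: "y \<in> S \<longleftrightarrow> real m < Re (cis (3 * pi / 4) * y) - Im (cis (3 * pi / 4) * y) \<and>
       Re (cis (3 * pi / 4) * y) - Im (cis (3 * pi / 4) * y) < real n + 1" for y
    unfolding Re_minus_Im_rot S_def by (auto simp: field_simps)
  have inj: "inj_on (\<lambda>k::nat. complex_of_nat k / cis (3 * pi / 4)) {m+1..n}" by (auto simp: inj_on_def)
  have ptsI: "y \<in> pts" if "y \<in> S" "cis (3 * pi / 4) * y \<in> \<int>" for y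
  proof -
    from Ints_half_plane[OF that(2)] that(1) obtain k where "k \<in> {m+1..n}" "cis (3 * pi / 4) * y = of_nat k"
      unfolding Srot by blast
    thus ?thesis unfolding pts_def by (intro image_eqI[of _ _ k]) (auto simp: field_simps)
  qed
  have "(LBINT x. rot_integrand s (Complex d x)) - (LBINT x. rot_integrand s (Complex c x))
      = 2 * pi * (\<Sum>p\<in>pts. residue (rot_integrand s) p)"
  proof (rule vertical_strip_residues[where S = S and h = h and T = "2 - c"])
    show "c < d" using \<open>a < b\<close> by (simp add: c_def d_def divide_strict_right_mono)
    show "open S" unfolding S_def by (intro open_Int open_halfspace_Re_lt open_halfspace_Re_gt)
    show "connected S" unfolding S_def
      by (intro convex_connected convex_Int convex_halfspace_Re_lt convex_halfspace_Re_gt)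
    show "finite pts" by (simp add: pts_def)
    show "{z. c \<le> Re z \<and> Re z \<le> d} \<subseteq> S"
      using a b by (auto simp: S_def c_def d_def field_simps)
    show "pts \<subseteq> {z. c < Re z \<and> Re z < d}"
    proof
      fix y assume "y \<in> pts"
      then obtain k where k: "k \<in> {m+1..n}" "cis (3 * pi / 4) * y = of_nat k" by (auto simp: pts_def)
      have "a < real k" "real k < b" using k(1) a b by auto
      moreover have "real k = - (sqrt 2 * Re y)" using Re_minus_Im_rot[of y] by (simp add: k)
      ultimately show "y \<in> {z. c < Re z \<and> Re z < d}" by (auto simp: c_def d_def field_simps)
    qed
    have "S \<subseteq> {y. Re y < 0}"
    proof
      fix y assume "y \<in> S"
      hence "Re y < - real m / sqrt 2" by (simp add: S_def)
      also have "\<dots> \<le> 0" by simp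
      finally show "y \<in> {y. Re y < 0}" by simp
    qed
    thus "rot_integrand s holomorphic_on S - pts"
      unfolding rot_integrand_def[abs_def] aux_integrand_def
      by (intro holomorphic_on_divide holomorphic_on_subset[OF holomorphic_rot_integrand_numerator] holomorphic_intros)
         (use ptsI in \<open>auto simp: sin_denominator_eq_0_iff[unfolded right_minus_eq]\<close>)
    show "integrable lborel (\<lambda>x. rot_integrand s (Complex c x))"
      using b nat_gap_notin_Ints[OF b] by (intro integrable_rot_integrand) (auto simp: c_def)
    show "integrable lborel (\<lambda>x. rot_integrand s (Complex d x))"
      using a nat_gap_notin_Ints[OF a] by (intro integrable_rot_integrand) (auto simp: d_def)
    show "norm (rot_integrand s z) \<le> h \<bar>Im z\<bar>" if "c \<le> Re z" "Re z \<le> d" "2 - c \<le> \<bar>Im z\<bar>" for z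
    proof -
      have "d < 0" using a by (simp add: d_def)
      thus ?thesis using that rot_integrand_decay[of c z s] unfolding h_def by simp
    qed
    show "(h \<longlongrightarrow> 0) at_top" unfolding h_def by real_asymp
  qed
  also have "(\<Sum>p\<in>pts. residue (rot_integrand s) p)
      = (\<Sum>k = m+1..n. of_nat k powr (- s) / (2 * pi * \<i> * cis (3 * pi / 4)))"
    unfolding pts_def using inj by (simp add: sum.reindex residue_rot_integrand)
  also have "\<dots> = (\<Sum>k = m+1..n. of_nat k powr (- s)) / (2 * pi * \<i> * cis (3 * pi / 4))"
    by (simp add: sum_divide_distrib)
  finally have "((LBINT x. rot_integrand s (Complex d x)) - (LBINT x. rot_integrand s (Complex c x))) * cis (- (3 * pi / 4))
     = (\<Sum>k = m+1..n. of_nat k powr (- s)) * (cis (- (3 * pi / 4)) / (\<i> * cis (3 * pi / 4)))"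
    by simp
  \<comment> \<open>The direction of the path cancels the factor left over from the residues, so
    each pole contributes exactly \<open>of_nat k powr (- s)\<close>.\<close>
  also have "cis (- (3 * pi / 4)) = \<i> * cis (3 * pi / 4)"
    unfolding cis_135 cis_m135 by (simp add: complex_eq_iff)
  hence "cis (- (3 * pi / 4)) / (\<i> * cis (3 * pi / 4)) = 1" by simp
  finally have "((LBINT x. rot_integrand s (Complex d x)) - (LBINT x. rot_integrand s (Complex c x))) * cis (- (3 * pi / 4))
     = (\<Sum>k = m+1..n. of_nat k powr (- s))" by simp
  thus ?thesis unfolding line_integral_rot c_def d_def left_diff_distrib diff_eq_eq .
qed

subsection \<open>The polynomials \<open>P_k\<close>\<close>

text \<open>The derivative of the function on the left is \<open>z^2 / (1 + z)\<close>, at most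
  \<open>2 * norm u ^ 2\<close> on the segment from 0 to \<open>u\<close>; the mean value inequality
  supplies the third power.\<close>

lemma norm_Ln_1p_cubic:
  fixes u :: complex
  assumes "norm u \<le> 1 / 2"
  shows "norm (Ln (1 + u) - u + u\<^sup>2 / 2) \<le> 2 * norm u ^ 3"
proof -
  define f where "f = (\<lambda>u::complex. Ln (1 + u) - u + u\<^sup>2 / 2)"
  have small: "norm z \<le> norm u" if "z \<in> closed_segment 0 u" for z
    using segment_bound1[OF that] by simp
  have ge: "1 / 2 \<le> norm (1 + z)" if "norm z \<le> norm u" for z :: complex
    using norm_triangle_ineq2[of 1 "- z"] that assms by (simp add: norm_minus_cancel)
  have "norm (f u - f 0) \<le> 2 * norm u ^ 2 * norm (u - 0)"
  proof (rule field_differentiable_bound[where S = "closed_segment 0 u" and f' = "\<lambda>z. z\<^sup>2 / (1 + z)"])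
    fix z assume z: "z \<in> closed_segment 0 u"
    have nz: "1 + z \<notin> \<real>\<^sub>\<le>\<^sub>0"
    proof
      assume "1 + z \<in> \<real>\<^sub>\<le>\<^sub>0"
      hence "Re z \<le> - 1" by (auto simp: complex_nonpos_Reals_iff)
      thus False using abs_Re_le_cmod[of z] small[OF z] assms by linarith
    qed
    hence "1 + z \<noteq> 0" by auto
    hence "inverse (1 + z) * (1 + z) = 1" by simp
    hence "inverse (1 + z) - 1 + z = z\<^sup>2 * inverse (1 + z)" by algebra
    hence eq: "1 / (1 + z) - 1 + z = z\<^sup>2 / (1 + z)"
      by (simp only: divide_inverse mult_1_left)
    have "(f has_field_derivative 1 / (1 + z) - 1 + z) (at z within closed_segment 0 u)"
      unfolding f_def using nz by (auto intro!: derivative_eq_intros simp: power2_eq_square inverse_eq_divide)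
    thus "(f has_field_derivative z\<^sup>2 / (1 + z)) (at z within closed_segment 0 u)"
      unfolding eq .
    have "norm (z\<^sup>2 / (1 + z)) \<le> norm u ^ 2 / (1 / 2)"
      unfolding norm_divide norm_power using small[OF z] ge[OF small[OF z]]
      by (intro frac_le power_mono) auto
    thus "norm (z\<^sup>2 / (1 + z)) \<le> 2 * norm u ^ 2" by simp
  qed auto
  thus ?thesis by (simp add: f_def power2_eq_square power3_eq_cube)
qed

text \<open>The scaled variable \<open>2 * \<i> * \<tau> * z\<close> is the relative displacement from the saddle point.\<close>

lemma gen_fun_eq:
  assumes "\<tau> \<noteq> 0"
  shows "gen_fun \<tau> z = exp (- (\<i> / (8 * \<tau>\<^sup>2)) *
    (Ln (1 + 2 * \<i> * \<tau> * z) - 2 * \<i> * \<tau> * z + (2 * \<i> * \<tau> * z)\<^sup>2 / 2))"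
proof -
  have "- (\<i> / (8 * \<tau>\<^sup>2)) * Ln (1 + 2 * \<i> * \<tau> * z) - z / (4 * \<tau>) + \<i> * z\<^sup>2 / 4
    = - (\<i> / (8 * \<tau>\<^sup>2)) * (Ln (1 + 2 * \<i> * \<tau> * z) - 2 * \<i> * \<tau> * z + (2 * \<i> * \<tau> * z)\<^sup>2 / 2)"
    using assms by (simp add: field_simps power2_eq_square)
  thus ?thesis unfolding gen_fun_def by (rule arg_cong)
qed

text \<open>The exponent is cubic in \<open>u = 2 * \<i> * \<tau> * z\<close>: it is at most
  \<open>2 * norm u ^ 3 / (8 * norm \<tau> ^ 2) = norm u * norm z ^ 2\<close>, and
  \<open>norm u \<le> 1 / 4\<close>.\<close>

lemma norm_gen_fun_le:
  assumes "\<tau> \<noteq> 0" "2 * norm (\<tau> * z) \<le> 1 / 4"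
  shows "norm (gen_fun \<tau> z) \<le> exp (norm z ^ 2 / 4)"
proof -
  define u where "u = 2 * \<i> * \<tau> * z"
  have u: "norm u = 2 * norm \<tau> * norm z" by (simp add: u_def norm_mult)
  have u4: "norm u \<le> 1 / 4" using assms(2) by (simp add: u norm_mult)
  have "norm (- (\<i> / (8 * \<tau>\<^sup>2)) * (Ln (1 + u) - u + u\<^sup>2 / 2))
      = norm (Ln (1 + u) - u + u\<^sup>2 / 2) / (8 * norm \<tau> ^ 2)"
    by (simp add: norm_mult norm_divide norm_power)
  also have "\<dots> \<le> 2 * norm u ^ 3 / (8 * norm \<tau> ^ 2)"
    using u4 by (intro divide_right_mono norm_Ln_1p_cubic) auto
  also have "2 * norm u ^ 3 = 2 * norm u * (4 * norm \<tau> ^ 2 * norm z ^ 2)"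
    by (simp add: u power2_eq_square power3_eq_cube)
  also have "\<dots> / (8 * norm \<tau> ^ 2) = norm u * norm z ^ 2"
    using assms(1) by (simp add: field_simps)
  also have "\<dots> \<le> 1 / 4 * norm z ^ 2" using u4 by (intro mult_right_mono) auto
  finally have le: "norm (- (\<i> / (8 * \<tau>\<^sup>2)) * (Ln (1 + u) - u + u\<^sup>2 / 2)) \<le> norm z ^ 2 / 4" by simp
  have "norm (gen_fun \<tau> z) \<le> exp (norm (- (\<i> / (8 * \<tau>\<^sup>2)) * (Ln (1 + u) - u + u\<^sup>2 / 2)))"
    unfolding gen_fun_eq[OF assms(1)] u_def[symmetric] by (rule norm_exp)
  also have "\<dots> \<le> exp (norm z ^ 2 / 4)" using le by simp
  finally show ?thesis .
qed

text \<open>At \<open>z = 0\<close> the radius used in the Cauchy estimate below degenerates, so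
  this case is computed directly.\<close>

lemma PP_0_arg: "PP k 0 = (if k = 0 then 1 else 0)"
proof -
  have g: "gen_fun \<tau> 0 = 1" for \<tau> by (simp add: gen_fun_def)
  have "remove_sings (\<lambda>\<tau>. gen_fun \<tau> 0) = (\<lambda>_. 1)"
    unfolding g by (intro ext remove_sings_eqI) simp
  hence "PP k 0 = fps_nth (fps_expansion (\<lambda>_. 1) 0) k" by (simp add: PP_def)
  thus ?thesis by (simp add: fps_expansion_def higher_deriv_const)
qed

text \<open>Cauchy's estimate on \<open>norm \<tau> = 1 / (8 * norm z)\<close>, the largest circle
  on which \<open>norm_gen_fun_le\<close> applies.\<close>

lemma norm_PP_le: "norm (PP k z) \<le> exp (norm z ^ 2 / 4) * (8 * norm z) ^ k"
proof (cases "z = 0")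
  case True
  thus ?thesis by (auto simp: PP_0_arg)
next
  case False
  define R where "R = 1 / (2 * norm z)"
  define r where "r = 1 / (8 * norm z)"
  have R: "0 < r" "r < R" using False by (auto simp: R_def r_def field_simps)
  \<comment> \<open>Division by 0 gives \<open>gen_fun 0 z\<close> the value
    \<open>exp (\<i> * z^2 / 4)\<close> instead of the limit, hence the patch at 0.\<close>
  define G where "G = (\<lambda>\<tau>. if \<tau> = 0 then PP 0 z else gen_fun \<tau> z)"
  have sums: "(\<lambda>k. PP k z * (\<tau> - 0) ^ k) sums G \<tau>" if "\<tau> \<in> ball 0 R" for \<tau>
  proof (cases "\<tau> = 0")
    case True
    have "(\<lambda>k. PP k z * 0 ^ k) sums PP 0 z" by (rule powser_sums_zero)
    thus ?thesis using True by (simp add: G_def)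
  next
    case False
    thus ?thesis using PP_sums[of \<tau> z] that \<open>z \<noteq> 0\<close>
      by (simp add: G_def R_def norm_mult field_simps)
  qed
  have holo: "G holomorphic_on ball 0 R"
    using sums by (rule power_series_holomorphic)
  have "\<forall>\<^sub>F \<tau> in nhds 0. \<tau> \<in> ball 0 R" using R by (intro eventually_nhds_in_open) auto
  hence "\<forall>\<^sub>F \<tau> in nhds 0. (\<lambda>k. fps_nth (Abs_fps (\<lambda>k. PP k z)) k * \<tau> ^ k) sums G \<tau>"
    by eventually_elim (use sums in simp)
  hence "G has_fps_expansion Abs_fps (\<lambda>k. PP k z)" by (rule has_fps_expansionI)
  from fps_nth_fps_expansion[OF this, of k] have "norm (PP k z) = norm ((deriv ^^ k) G 0) / fact k"
    by (simp add: norm_divide)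
  moreover have "norm ((deriv ^^ k) G 0) \<le> fact k * exp (norm z ^ 2 / 4) / r ^ k"
  proof (rule Cauchy_inequality)
    show "G holomorphic_on ball 0 r" using R by (intro holomorphic_on_subset[OF holo]) auto
    show "continuous_on (cball 0 r) G"
      using R by (intro holomorphic_on_imp_continuous_on holomorphic_on_subset[OF holo]) auto
    show "0 < r" by fact
    fix x :: complex assume x: "norm (0 - x) = r"
    hence "x \<noteq> 0" using R by auto
    thus "norm (G x) \<le> exp (norm z ^ 2 / 4)"
      unfolding G_def using x False by (auto intro!: norm_gen_fun_le simp: norm_mult r_def)
  qed
  ultimately have "norm (PP k z) \<le> exp (norm z ^ 2 / 4) / r ^ k"
    by (simp add: pos_divide_le_eq mult.commute)
  thus ?thesis by (simp add: r_def power_divide power_mult_distrib)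
qed

lemma measurable_gen_fun [measurable]: "gen_fun \<tau> \<in> borel_measurable borel"
  unfolding gen_fun_def[abs_def] by measurable

text \<open>The recovery of each coefficient as a limit of quotients serves to show that \<open>PP k\<close> is
  measurable.\<close>

lemma PP_tendsto:
  "(\<lambda>n. (gen_fun (1 / of_nat (Suc n)) z - (\<Sum>j<k. PP j z * (1 / of_nat (Suc n)) ^ j)) * of_nat (Suc n) ^ k)
     \<longlonglongrightarrow> PP k z"
proof -
  define \<tau> where "\<tau> = (\<lambda>n. 1 / of_nat (Suc n) :: complex)"
  have tau0: "\<tau> \<longlonglongrightarrow> 0" unfolding \<tau>_def using LIMSEQ_Suc[OF lim_1_over_n[where 'a = complex]] by simp
  have tau_nz: "\<tau> n \<noteq> 0" for n unfolding \<tau>_def using of_nat_neq_0[of n] by simp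
  define r where "r = 1 / (2 * norm z + 1)"
  have r: "0 < r" "2 * norm z * r < 1" unfolding r_def by (auto simp: field_simps add_pos_nonneg)
  have sm: "summable (\<lambda>j. PP (j + k) z * x ^ j)" if "norm x < r" for x
  proof (cases "x = 0")
    case True
    thus ?thesis by (simp add: summable_0_powser)
  next
    case False
    have "2 * norm (x * z) \<le> 2 * norm z * r"
      using that mult_left_mono[of "norm x" r "norm z"] by (simp add: norm_mult mult_ac)
    hence "summable (\<lambda>j. PP j z * x ^ j)" using PP_sums[of x z] False r by (auto simp: sums_iff)
    hence "summable (\<lambda>j. PP (j + k) z * x ^ (j + k))" by (subst summable_iff_shift)
    hence "summable (\<lambda>j. (PP (j + k) z * x ^ (j + k)) / x ^ k)" by (rule summable_divide)
    thus ?thesis using False by (simp add: power_add)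
  qed
  have "(\<lambda>j. PP (j + k) z * x ^ j) sums (\<Sum>j. PP (j + k) z * x ^ j)" if "norm x < r" for x
    using sm[OF that] by (rule summable_sums)
  from powser_limit_0[where a = "\<lambda>j. PP (j + k) z", OF r(1) this]
  have lim: "((\<lambda>x. \<Sum>j. PP (j + k) z * x ^ j) \<longlongrightarrow> PP k z) (at 0)" by simp
  have "(\<lambda>n. \<Sum>j. PP (j + k) z * \<tau> n ^ j) \<longlonglongrightarrow> PP k z"
    by (rule filterlim_compose[OF lim]) (use tau0 tau_nz in \<open>auto simp: filterlim_at\<close>)
  moreover have "\<forall>\<^sub>F n in sequentially. (\<Sum>j. PP (j + k) z * \<tau> n ^ j)
      = (gen_fun (\<tau> n) z - (\<Sum>j<k. PP j z * \<tau> n ^ j)) * of_nat (Suc n) ^ k"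
  proof -
    have "\<forall>\<^sub>F n in sequentially. norm (\<tau> n) < r"
      using tendstoD[OF tau0 r(1)] by simp
    thus ?thesis
    proof eventually_elim
      case (elim n)
      note t0 = tau_nz[of n]
      have "2 * norm (\<tau> n * z) \<le> 2 * norm z * r" 
        using elim mult_left_mono[of "norm (\<tau> n)" r "norm z"] by (simp add: norm_mult mult_ac)
      hence s: "(\<lambda>j. PP j z * \<tau> n ^ j) sums gen_fun (\<tau> n) z" using PP_sums[OF t0, of z] r by auto
      have "(\<lambda>j. PP (j + k) z * \<tau> n ^ (j + k)) sums (gen_fun (\<tau> n) z - (\<Sum>j<k. PP j z * \<tau> n ^ j))"
        using sums_split_initial_segment[OF s, of k] by simp
      from sums_divide[OF this, of "\<tau> n ^ k"]
      have "(\<lambda>j. PP (j + k) z * \<tau> n ^ j) sums ((gen_fun (\<tau> n) z - (\<Sum>j<k. PP j z * \<tau> n ^ j)) / \<tau> n ^ k)"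
        using t0 by (simp add: power_add)
      thus ?case by (simp add: sums_iff \<tau>_def power_divide)
    qed
  qed
  ultimately show ?thesis unfolding \<tau>_def by (rule Lim_transform_eventually)
qed

lemma measurable_PP [measurable]: "PP k \<in> borel_measurable borel"
proof (induction k rule: less_induct)
  case (less k)
  show ?case
  proof (rule borel_measurable_LIMSEQ_metric[OF _ PP_tendsto])
    show "(\<lambda>z. (gen_fun (1 / of_nat (Suc n)) z - (\<Sum>j<k. PP j z * (1 / of_nat (Suc n)) ^ j)) * of_nat (Suc n) ^ k)
        \<in> borel_measurable borel" for n
      using less by (intro borel_measurable_times borel_measurable_diff borel_measurable_sum measurable_gen_fun
          borel_measurable_const) auto
  qed
qed

text \<open>By \<open>norm_PP_le\<close> the tail is dominated by a geometric series of ratio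
  \<open>8 * norm (\<tau> * z) \<le> 1 / 2\<close>, whose sum contributes the factor 2.\<close>

lemma gen_fun_remainder_le:
  assumes "\<tau> \<noteq> 0" "8 * norm (\<tau> * z) \<le> 1 / 2"
  shows "norm (gen_fun \<tau> z - (\<Sum>k\<le>K. PP k z * \<tau> ^ k)) \<le> 2 * exp (norm z ^ 2 / 4) * (8 * norm (\<tau> * z)) ^ (K + 1)"
proof -
  define x where "x = 8 * norm (\<tau> * z)"
  have x: "0 \<le> x" "x \<le> 1 / 2" using assms(2) by (auto simp: x_def)
  have "(\<lambda>j. PP j z * \<tau> ^ j) sums gen_fun \<tau> z"
    using assms by (intro PP_sums) auto
  from sums_split_initial_segment[OF this, of "Suc K"]
  have s: "(\<lambda>j. PP (j + Suc K) z * \<tau> ^ (j + Suc K)) sums (gen_fun \<tau> z - (\<Sum>k\<le>K. PP k z * \<tau> ^ k))"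
    by (simp only: lessThan_Suc_atMost)
  have b: "norm (PP (j + Suc K) z * \<tau> ^ (j + Suc K)) \<le> exp (norm z ^ 2 / 4) * x ^ Suc K * x ^ j" for j
  proof -
    have "norm (PP (j + Suc K) z * \<tau> ^ (j + Suc K))
        \<le> exp (norm z ^ 2 / 4) * (8 * norm z) ^ (j + Suc K) * norm \<tau> ^ (j + Suc K)"
      unfolding norm_mult norm_power by (intro mult_right_mono norm_PP_le) auto
    also have "\<dots> = exp (norm z ^ 2 / 4) * (x ^ (j + Suc K))"
      by (simp add: x_def norm_mult power_mult_distrib mult_ac)
    finally show ?thesis by (simp only: power_add mult_ac)
  qed
  have gs: "(\<lambda>j. exp (norm z ^ 2 / 4) * x ^ Suc K * x ^ j) sums (exp (norm z ^ 2 / 4) * x ^ Suc K * (1 / (1 - x)))"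
    using x by (intro sums_mult geometric_sums) auto
  have "norm (gen_fun \<tau> z - (\<Sum>k\<le>K. PP k z * \<tau> ^ k)) \<le> exp (norm z ^ 2 / 4) * x ^ Suc K * (1 / (1 - x))"
    using norm_suminf_le[of "\<lambda>j. PP (j + Suc K) z * \<tau> ^ (j + Suc K)", OF b] s gs by (simp add: sums_iff)
  also have "\<dots> \<le> exp (norm z ^ 2 / 4) * x ^ Suc K * 2"
    using x by (intro mult_left_mono) (auto simp: field_simps)
  finally show ?thesis by (simp add: x_def mult_ac)
qed

text \<open>In the complementary range twice the ratio is at least 1, so every lower power is
  dominated by the power \<open>K + 1\<close>: no cancellation against the generating function is
  called for.\<close>

lemma PP_partial_sum_le:
  assumes "1 / 2 \<le> 8 * norm (\<tau> * z)"
  shows "norm (\<Sum>k\<le>K. PP k z * \<tau> ^ k) \<le> (K + 1) * 2 ^ (K + 1) * exp (norm z ^ 2 / 4) * (8 * norm (\<tau> * z)) ^ (K + 1)"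
proof -
  define x where "x = 8 * norm (\<tau> * z)"
  have x: "1 \<le> 2 * x" using assms by (auto simp: x_def)
  have "norm (\<Sum>k\<le>K. PP k z * \<tau> ^ k) \<le> (\<Sum>k\<le>K. exp (norm z ^ 2 / 4) * (2 * x) ^ (K + 1))"
  proof (rule sum_norm_le)
    fix k assume k: "k \<in> {..K}"
    have "norm (PP k z * \<tau> ^ k) \<le> exp (norm z ^ 2 / 4) * (8 * norm z) ^ k * norm \<tau> ^ k"
      unfolding norm_mult norm_power by (intro mult_right_mono norm_PP_le) auto
    also have "\<dots> = exp (norm z ^ 2 / 4) * x ^ k"
      by (simp add: x_def norm_mult power_mult_distrib mult_ac)
    also have "x ^ k \<le> (2 * x) ^ k" using x by (intro power_mono) auto
    also have "(2 * x) ^ k \<le> (2 * x) ^ (K + 1)" using x k by (intro power_increasing) auto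
    finally show "norm (PP k z * \<tau> ^ k) \<le> exp (norm z ^ 2 / 4) * (2 * x) ^ (K + 1)" by simp
  qed
  also have "\<dots> = (K + 1) * 2 ^ (K + 1) * exp (norm z ^ 2 / 4) * x ^ (K + 1)"
    by (simp add: power_mult_distrib algebra_simps)
  finally show ?thesis unfolding x_def
    by (simp only: of_nat_mult of_nat_add of_nat_power of_nat_1 of_nat_numeral)
qed

subsection \<open>Decay of the phase along lines through the saddle point\<close>

lemma Arg_ge_pi_div_4:
  assumes "0 < Im w" "Re w \<le> Im w"
  shows "pi / 4 \<le> Arg w"
proof (rule ccontr)
  assume "\<not> pi / 4 \<le> Arg w"
  moreover have "0 < Arg w" using assms Arg_lt_pi[of w] by simp
  ultimately have "cos (pi / 4) < cos (Arg w)" "sin (Arg w) < sin (pi / 4)"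
    by (auto intro!: cos_monotone_0_pi sin_monotone_2pi)
  hence "sin (Arg w) < cos (Arg w)" by (simp add: cos_45 sin_45)
  moreover have "w \<noteq> 0" using assms by auto
  ultimately have "norm w * sin (Arg w) < norm w * cos (Arg w)" by (simp add: mult_strict_left_mono)
  also have "norm w * sin (Arg w) = Im w"
    using arg_cong[OF rcis_cmod_Arg[of w], of Im] by simp
  also have "norm w * cos (Arg w) = Re w"
    using arg_cong[OF rcis_cmod_Arg[of w], of Re] by simp
  finally show False using assms by simp
qed

text \<open>Up to the factor \<open>- 2 * pi * norm \<xi> ^ 2\<close> this is the real part of the
  exponent at \<open>u = \<rho> * cis \<phi>\<close>, for
  \<open>\<phi> = pi / 4 - Arg \<xi>\<close>. The factor \<open>cis (- 2 * \<phi>)\<close> makes its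
  leading term \<open>\<rho>^2\<close>.\<close>

definition ray_phase :: "real \<Rightarrow> real \<Rightarrow> real" where
  "ray_phase \<phi> \<rho> = Re (cis (- 2 * \<phi>) * (of_real \<rho> * cis \<phi> + (of_real \<rho> * cis \<phi>)\<^sup>2 / 2 - Ln (1 + of_real \<rho> * cis \<phi>)))"

lemma norm_1p_ray: "(norm (1 + of_real \<rho> * cis \<phi>))\<^sup>2 = 1 + 2 * \<rho> * cos \<phi> + \<rho>\<^sup>2"
proof -
  have "(norm (1 + of_real \<rho> * cis \<phi>))\<^sup>2 = (1 + \<rho> * cos \<phi>)\<^sup>2 + (\<rho> * sin \<phi>)\<^sup>2"
    by (simp add: cmod_power2)
  also have "\<dots> = 1 + 2 * \<rho> * cos \<phi> + \<rho>\<^sup>2 * ((sin \<phi>)\<^sup>2 + (cos \<phi>)\<^sup>2)"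
  proof -
    have "(1 + \<rho> * c)\<^sup>2 + (\<rho> * s)\<^sup>2 = 1 + 2 * \<rho> * c + \<rho>\<^sup>2 * (s\<^sup>2 + c\<^sup>2)" for c s :: real
      by (simp add: power2_eq_square algebra_simps)
    thus ?thesis .
  qed
  finally show ?thesis by simp
qed

lemma ray_notin_nonpos_Reals:
  assumes "0 < \<phi>" "\<phi> < pi" "0 \<le> \<rho>"
  shows "1 + of_real \<rho> * cis \<phi> \<notin> \<real>\<^sub>\<le>\<^sub>0"
  using assms sin_gt_zero[of \<phi>] by (auto simp: complex_nonpos_Reals_iff)

text \<open>The derivative of \<open>u + u^2 / 2 - Ln (1 + u)\<close> is
  \<open>u * (1 + 1 / (1 + u))\<close>. Along the ray the square of the direction cancels and
  \<open>\<rho> * Re (1 + 1 / w)\<close> remains, so growth hinges on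
  \<open>Re (1 / w) > - 1\<close>.\<close>

lemma ray_phase_deriv:
  assumes "0 < \<phi>" "\<phi> < pi" "0 \<le> \<rho>"
  shows "(ray_phase \<phi> has_real_derivative \<rho> * (1 + (1 + \<rho> * cos \<phi>) / (1 + 2 * \<rho> * cos \<phi> + \<rho>\<^sup>2))) (at \<rho>)"
proof -
  define w where "w = 1 + of_real \<rho> * cis \<phi>"
  have w: "w \<notin> \<real>\<^sub>\<le>\<^sub>0" using ray_notin_nonpos_Reals[OF assms] by (simp add: w_def)
  hence w0: "w \<noteq> 0" by auto
  have "((\<lambda>z. cis (- 2 * \<phi>) * (z * cis \<phi> + (z * cis \<phi>)\<^sup>2 / 2 - Ln (1 + z * cis \<phi>))) has_field_derivative
      cis (- 2 * \<phi>) * (cis \<phi> + of_real \<rho> * cis \<phi> * cis \<phi> - cis \<phi> / w)) (at (of_real \<rho>))"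
    using w unfolding w_def by (auto intro!: derivative_eq_intros simp: field_simps power2_eq_square)
  from bounded_linear.has_vector_derivative[OF bounded_linear_Re has_vector_derivative_real_field[OF this]]
  have "(ray_phase \<phi> has_real_derivative Re (cis (- 2 * \<phi>) * (cis \<phi> + of_real \<rho> * cis \<phi> * cis \<phi> - cis \<phi> / w))) (at \<rho>)"
    unfolding ray_phase_def[abs_def] has_real_derivative_iff_has_vector_derivative .
  also have "cis \<phi> + of_real \<rho> * cis \<phi> * cis \<phi> - cis \<phi> / w = cis \<phi> * cis \<phi> * (of_real \<rho> * (1 + 1 / w))"
  proof -
    have "inverse w * w = 1" "of_real \<rho> * cis \<phi> = w - 1" using w0 by (simp_all add: w_def)
    hence "cis \<phi> + of_real \<rho> * cis \<phi> * cis \<phi> - cis \<phi> * inverse w = cis \<phi> * cis \<phi> * (of_real \<rho> * (1 + inverse w))"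
      by algebra
    thus ?thesis by (simp add: divide_inverse)
  qed
  also have "cis (- 2 * \<phi>) * (cis \<phi> * cis \<phi> * (of_real \<rho> * (1 + 1 / w))) = of_real \<rho> * (1 + 1 / w)"
    by (simp add: mult.assoc[symmetric] cis_mult)
  also have "Re (of_real \<rho> * (1 + 1 / w)) = \<rho> * (1 + (1 + \<rho> * cos \<phi>) / (norm w)\<^sup>2)"
    by (simp add: Re_divide cmod_power2 w_def)
  finally show ?thesis unfolding w_def norm_1p_ray .
qed

text \<open>In both cases \<open>Re (1 / w) \<ge> - 9 / 10\<close>, so the derivative is at least
  \<open>\<rho> / 10\<close>, and integration gives \<open>\<rho>^2 / 20\<close>.\<close>

lemma ray_phase_ge_near:
  assumes "0 < \<phi>" "\<phi> < pi" "0 \<le> \<rho>" "\<rho> \<le> 1 \<or> - 9 / 10 \<le> cos \<phi>"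
  shows "\<rho>\<^sup>2 / 20 \<le> ray_phase \<phi> \<rho>"
proof -
  have "ray_phase \<phi> 0 - 0\<^sup>2 / 20 \<le> ray_phase \<phi> \<rho> - \<rho>\<^sup>2 / 20"
  proof (rule DERIV_nonneg_imp_nondecreasing[OF assms(3)])
    fix x :: real assume x: "0 \<le> x" "x \<le> \<rho>"
    define b where "b = cos \<phi>"
    define N where "N = 1 + 2 * x * b + x\<^sup>2"
    have "0 < N"
      using ray_notin_nonpos_Reals[OF assms(1,2) x(1)]
      unfolding N_def b_def norm_1p_ray[symmetric] by force
    have "\<bar>b\<bar> \<le> 1" by (simp add: b_def)
    have "0 \<le> 9 / 10 * N + (1 + x * b)"
    proof (cases "x \<le> 1")
      case True
      have "\<bar>x * b\<bar> \<le> 1 * 1" unfolding abs_mult using True x \<open>\<bar>b\<bar> \<le> 1\<close> by (intro mult_mono) auto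
      thus ?thesis using \<open>0 < N\<close> by linarith
    next
      case False
      hence "- 9 / 10 \<le> b" using assms(4) x by (auto simp: b_def)
      hence "x * (- 9 / 10) \<le> x * b" using x by (intro mult_left_mono) auto
      \<comment> \<open>\<open>7 / 5\<close> is the vertex of
        \<open>9 / 10 * x^2 - 63 / 25 * x\<close>; the constant \<open>19 / 10 - 441 / 250\<close>
        that remains is positive.\<close>
      moreover have "0 \<le> 9 / 10 * (x - 7 / 5)\<^sup>2" by simp
      moreover have "9 / 10 * (x - 7 / 5)\<^sup>2 = 9 / 10 * x\<^sup>2 - 63 / 25 * x + 441 / 250"
        by (simp add: power2_diff algebra_simps power2_eq_square)
      moreover have "9 / 10 * N + (1 + x * b) = 19 / 10 + 14 / 5 * (x * b) + 9 / 10 * x\<^sup>2"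
        by (simp add: N_def algebra_simps)
      ultimately show ?thesis by linarith
    qed
    hence "0 \<le> (9 / 10 * N + (1 + x * b)) / N" using \<open>0 < N\<close> by simp
    also have "\<dots> = 1 + (1 + x * b) / N - 1 / 10" using \<open>0 < N\<close> by (simp add: field_simps)
    finally have "0 \<le> x * (1 + (1 + x * b) / N - 1 / 10)" using x by simp
    moreover have "((\<lambda>x. ray_phase \<phi> x - x\<^sup>2 / 20) has_real_derivative x * (1 + (1 + x * b) / N) - x / 10) (at x)"
      unfolding N_def b_def by (auto intro!: derivative_eq_intros ray_phase_deriv[OF assms(1,2) x(1)])
    ultimately show "\<exists>y. ((\<lambda>x. ray_phase \<phi> x - x\<^sup>2 / 20) has_real_derivative y) (at x) \<and> 0 \<le> y"
      by (auto simp: algebra_simps)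
  qed
  thus ?thesis by (simp add: ray_phase_def)
qed

text \<open>For directions pointing almost back to the origin the ray passes close to the branch point;
  there the argument of \<open>1 + u\<close> compensates the logarithmic term.\<close>

lemma ray_phase_ge_far:
  assumes "0 < \<phi>" "\<phi> < pi" "1 \<le> \<rho>" "cos \<phi> < - 9 / 10"
  shows "(sin \<phi>)\<^sup>2 / 2 * \<rho>\<^sup>2 \<le> ray_phase \<phi> \<rho>"
proof -
  define w where "w = 1 + of_real \<rho> * cis \<phi>"
  define b s where "b = - cos \<phi>" and "s = sin \<phi>"
  define N where "N = 1 - 2 * \<rho> * b + \<rho>\<^sup>2"
  have w: "w \<notin> \<real>\<^sub>\<le>\<^sub>0" using ray_notin_nonpos_Reals[OF assms(1,2)] assms(3) by (simp add: w_def)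
  hence w0: "w \<noteq> 0" by auto
  have s: "0 < s" using assms sin_gt_zero by (simp add: s_def)
  have b: "9 / 10 < b" using assms by (simp add: b_def)
  have sb: "s\<^sup>2 + b\<^sup>2 = 1" by (simp add: s_def b_def)
  \<comment> \<open>This says \<open>Re w \<le> Im w\<close>, as
    \<open>Re w = 1 - \<rho> * b\<close> and \<open>Im w = \<rho> * s\<close>; it bounds
    \<open>Arg w\<close> from below.\<close>
  have "1 * 1 \<le> \<rho> * (s + b)"
  proof (rule mult_mono)
    have "(s + b)\<^sup>2 = 1 + 2 * s * b" using sb by (simp add: power2_eq_square algebra_simps)
    hence "1\<^sup>2 \<le> (s + b)\<^sup>2" using s b by simp
    thus "1 \<le> s + b" using s b by (intro power2_le_imp_le[of 1 "s + b"]) auto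
  qed (use assms in auto)
  hence A: "pi / 4 \<le> Arg w"
    using s assms by (intro Arg_ge_pi_div_4) (auto simp: w_def b_def s_def algebra_simps)
  have N: "(norm w)\<^sup>2 = N" unfolding w_def norm_1p_ray by (simp add: N_def b_def)
  have "0 < N" using w0 N[symmetric] by simp
  have "ray_phase \<phi> \<rho> = Re (cis (- 2 * \<phi>) * (of_real \<rho> * cis \<phi>)) + Re (cis (- 2 * \<phi>) * (of_real \<rho> * cis \<phi>)\<^sup>2) / 2
      - Re (cis (- 2 * \<phi>) * Ln w)"
    unfolding ray_phase_def w_def by (simp add: algebra_simps)
  also have "cis (- 2 * \<phi>) * (of_real \<rho> * cis \<phi>) = of_real \<rho> * cis (- \<phi>)"
    by (simp add: mult.left_commute cis_mult)
  also have "cis (- 2 * \<phi>) * (of_real \<rho> * cis \<phi>)\<^sup>2 = of_real (\<rho>\<^sup>2)"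
    by (simp add: power_mult_distrib mult.left_commute cis_mult power2_eq_square)
  also have "Re (cis (- 2 * \<phi>) * Ln w) = cos (2 * \<phi>) * ln (norm w) + sin (2 * \<phi>) * Arg w"
    using w0 by (simp add: Re_Ln Arg_eq_Im_Ln)
  also have "cos (2 * \<phi>) = 2 * b\<^sup>2 - 1" by (simp add: cos_double_cos b_def)
  also have "sin (2 * \<phi>) = - 2 * s * b" by (simp add: sin_double s_def b_def)
  also have "ln (norm w) = ln N / 2"
    unfolding N[symmetric] using w0 by (simp add: ln_realpow)
  finally have eq: "ray_phase \<phi> \<rho> = - \<rho> * b + \<rho>\<^sup>2 / 2 - (2 * b\<^sup>2 - 1) * (ln N / 2) + 2 * s * b * Arg w"
    by (simp add: b_def)
  have "81 / 100 \<le> b\<^sup>2" using mult_mono[of "9/10" b "9/10" b] b by (simp add: power2_eq_square)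
  hence "(2 * b\<^sup>2 - 1) * (ln N / 2) \<le> (2 * b\<^sup>2 - 1) * ((N - 1) / 2)"
    using ln_le_minus_one[OF \<open>0 < N\<close>] by (intro mult_left_mono) auto
  moreover have "2 * s * b * (pi / 4) \<le> 2 * s * b * Arg w" using A s b by (intro mult_left_mono) auto
  ultimately have "- \<rho> * b + \<rho>\<^sup>2 / 2 - (2 * b\<^sup>2 - 1) * ((N - 1) / 2) + 2 * s * b * (pi / 4) \<le> ray_phase \<phi> \<rho>"
    unfolding eq by linarith
  also have "- \<rho> * b + \<rho>\<^sup>2 / 2 - (2 * b\<^sup>2 - 1) * ((N - 1) / 2) = (1 - b\<^sup>2) * (\<rho>\<^sup>2 - 2 * \<rho> * b)"
    by (simp add: N_def field_simps power2_eq_square)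
  also have "1 - b\<^sup>2 = s\<^sup>2" using sb by simp
  finally have 1: "s\<^sup>2 * (\<rho>\<^sup>2 - 2 * \<rho> * b) + 2 * s * b * (pi / 4) \<le> ray_phase \<phi> \<rho>" .
  have "\<rho>\<^sup>2 / 2 - 2 * b\<^sup>2 \<le> \<rho>\<^sup>2 - 2 * \<rho> * b"
    using zero_le_power2[of "\<rho> - 2 * b"] by (simp add: power2_eq_square algebra_simps)
  hence "s\<^sup>2 * (\<rho>\<^sup>2 / 2 - 2 * b\<^sup>2) \<le> s\<^sup>2 * (\<rho>\<^sup>2 - 2 * \<rho> * b)" by (intro mult_left_mono) auto
  \<comment> \<open>The loss \<open>2 * s^2 * b^2\<close> in the preceding inequality is paid by the
    argument term \<open>2 * s * b * (pi / 4)\<close>.\<close>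
  moreover have "(2 * s * b) * (s * b) \<le> (pi / 2) * (s * b)"
  proof (rule mult_right_mono)
    have "2 * s * b \<le> 1" using sb zero_le_power2[of "s - b"] by (simp add: power2_eq_square algebra_simps)
    also have "1 \<le> pi / 2" using pi_ge_two by simp
    finally show "2 * s * b \<le> pi / 2" .
  qed (use s b in auto)
  ultimately have "s\<^sup>2 / 2 * \<rho>\<^sup>2 \<le> ray_phase \<phi> \<rho>" using 1 by (simp add: power2_eq_square algebra_simps)
  thus ?thesis by (simp add: s_def)
qed

text \<open>A negative \<rho> is reduced to a positive one by conjugation, which replaces \<phi> by
  \<open>pi - \<phi>\<close> and keeps the sine.\<close>

lemma ray_phase_ge:
  assumes "0 < \<phi>" "\<phi> < pi"
  shows "min (1 / 20) ((sin \<phi>)\<^sup>2 / 2) * \<rho>\<^sup>2 \<le> ray_phase \<phi> \<rho>"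
proof -
  have *: "min (1 / 20) ((sin \<phi>)\<^sup>2 / 2) * \<rho>\<^sup>2 \<le> ray_phase \<phi> \<rho>" if "0 < \<phi>" "\<phi> < pi" "0 \<le> \<rho>" for \<phi> \<rho>
  proof (cases "\<rho> \<le> 1 \<or> - 9 / 10 \<le> cos \<phi>")
    case True
    have "min (1 / 20) ((sin \<phi>)\<^sup>2 / 2) * \<rho>\<^sup>2 \<le> 1 / 20 * \<rho>\<^sup>2" by (intro mult_right_mono) auto
    thus ?thesis using ray_phase_ge_near[OF that True] by simp
  next
    case False
    have "min (1 / 20) ((sin \<phi>)\<^sup>2 / 2) * \<rho>\<^sup>2 \<le> (sin \<phi>)\<^sup>2 / 2 * \<rho>\<^sup>2" by (intro mult_right_mono) auto
    thus ?thesis using ray_phase_ge_far[of \<phi> \<rho>] that False by linarith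
  qed
  show ?thesis
  proof (cases "0 \<le> \<rho>")
    case False
    define \<psi> where "\<psi> = pi - \<phi>"
    have \<psi>: "0 < \<psi>" "\<psi> < pi" using assms by (auto simp: \<psi>_def)
    have c: "of_real \<rho> * cis \<phi> = cnj (of_real (- \<rho>) * cis \<psi>)" "cis (- 2 * \<phi>) = cnj (cis (- 2 * \<psi>))"
      by (simp_all add: complex_eq_iff \<psi>_def cos_diff sin_diff right_diff_distrib)
    have L: "Ln (1 + of_real \<rho> * cis \<phi>) = cnj (Ln (1 + of_real (- \<rho>) * cis \<psi>))"
      using ray_notin_nonpos_Reals[OF \<psi>, of "- \<rho>"] False unfolding c(1) by (subst cnj_Ln) auto
    have "ray_phase \<phi> \<rho> = Re (cnj (cis (- 2 * \<psi>) * (of_real (- \<rho>) * cis \<psi> + (of_real (- \<rho>) * cis \<psi>)\<^sup>2 / 2 - Ln (1 + of_real (- \<rho>) * cis \<psi>))))"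
      unfolding ray_phase_def L unfolding c by simp
    hence "ray_phase \<phi> \<rho> = ray_phase \<psi> (- \<rho>)" by (simp only: ray_phase_def complex_cnj cnj.sel)
    thus ?thesis using *[OF \<psi>, of "- \<rho>"] False by (simp add: \<psi>_def)
  qed (use * assms in auto)
qed

definition phase :: "complex \<Rightarrow> complex \<Rightarrow> complex" where
  "phase \<xi> u = 2 * pi * \<i> * \<xi>\<^sup>2 * (u + u\<^sup>2 / 2 - Ln (1 + u))"

text \<open>For \<open>\<phi> = pi / 4 - Arg \<xi>\<close> one has
  \<open>\<i> * \<xi>^2 = - (norm \<xi>)^2 * cis (- 2 * \<phi>)\<close>, the prefactor that
  \<open>ray_phase\<close> is built for. As \<open>\<rho> = r / norm \<xi>\<close>, the size of
  \<xi> drops out.\<close>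

lemma phase_le_through_saddle:
  assumes "\<xi> \<noteq> 0" "- (3 * pi / 4) < Arg \<xi>" "Arg \<xi> < pi / 4"
  shows "Re (phase \<xi> (of_real r * cis (pi / 4) / \<xi>))
    \<le> - (2 * pi * min (1 / 20) ((sin (pi / 4 - Arg \<xi>))\<^sup>2 / 2)) * r\<^sup>2"
proof -
  define \<phi> R where "\<phi> = pi / 4 - Arg \<xi>" and "R = norm \<xi>"
  have \<phi>: "0 < \<phi>" "\<phi> < pi" using assms by (auto simp: \<phi>_def)
  have R: "0 < R" using assms by (simp add: R_def)
  have \<xi>: "\<xi> = of_real R * cis (pi / 4 - \<phi>)"
    using rcis_cmod_Arg[of \<xi>] by (simp add: R_def \<phi>_def rcis_def)
  have u: "of_real r * cis (pi / 4) / \<xi> = of_real (r / R) * cis \<phi>"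
    unfolding \<xi> using R by (simp add: field_simps cis_mult)
  have "\<xi>\<^sup>2 = of_real (R\<^sup>2) * cis (pi / 2 - 2 * \<phi>)"
    unfolding \<xi> by (simp add: power_mult_distrib power2_eq_square cis_mult)
  also have "cis (pi / 2 - 2 * \<phi>) = \<i> * cis (- 2 * \<phi>)"
    by (simp add: complex_eq_iff cos_diff sin_diff)
  finally have "2 * pi * \<i> * \<xi>\<^sup>2 = of_real (- (2 * pi * R\<^sup>2)) * cis (- 2 * \<phi>)" by (simp add: mult_ac)
  hence "phase \<xi> (of_real r * cis (pi / 4) / \<xi>) = of_real (- (2 * pi * R\<^sup>2)) * (cis (- 2 * \<phi>) *
     (of_real (r / R) * cis \<phi> + (of_real (r / R) * cis \<phi>)\<^sup>2 / 2 - Ln (1 + of_real (r / R) * cis \<phi>)))"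
    unfolding phase_def u by (simp only: mult.assoc)
  hence "Re (phase \<xi> (of_real r * cis (pi / 4) / \<xi>)) = - (2 * pi * R\<^sup>2) * ray_phase \<phi> (r / R)"
    unfolding ray_phase_def by (simp only: Re_complex_of_real Im_complex_of_real times_complex.sel mult_zero_left diff_zero)
  also have "\<dots> \<le> - (2 * pi * R\<^sup>2) * (min (1 / 20) ((sin \<phi>)\<^sup>2 / 2) * (r / R)\<^sup>2)"
    using ray_phase_ge[OF \<phi>, of "r / R"] by (intro mult_left_mono_neg) auto
  also have "\<dots> = - (2 * pi * min (1 / 20) ((sin \<phi>)\<^sup>2 / 2)) * r\<^sup>2"
    using R by (simp add: power_divide)
  finally show ?thesis by (simp add: \<phi>_def)
qed


lemma Re_minus_Im_eq: "Re \<xi> - Im \<xi> = sqrt 2 * norm \<xi> * sin (pi / 4 - Arg \<xi>)"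
proof -
  have "Re \<xi> = norm \<xi> * cos (Arg \<xi>)" "Im \<xi> = norm \<xi> * sin (Arg \<xi>)"
    using arg_cong[OF rcis_cmod_Arg[of \<xi>], of Re] arg_cong[OF rcis_cmod_Arg[of \<xi>], of Im] by simp_all
  thus ?thesis by (simp add: sin_diff cos_45 sin_45 algebra_simps)
qed

lemma norm_ge_Re_minus_Im: "Re w - Im w \<le> sqrt 2 * norm w"
proof -
  have "sqrt 2 * norm w * sin (pi / 4 - Arg w) \<le> sqrt 2 * norm w * 1" by (intro mult_left_mono) auto
  thus ?thesis by (simp add: Re_minus_Im_eq)
qed

lemma phase_deriv:
  assumes "1 + y \<notin> \<real>\<^sub>\<le>\<^sub>0"
  shows "(phase \<xi> has_field_derivative 2 * pi * \<i> * \<xi>\<^sup>2 * (y * (1 + 1 / (1 + y)))) (at y within S)"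
proof -
  have "1 + y \<noteq> 0" using assms by auto
  hence "inverse (1 + y) * (1 + y) = 1" by simp
  hence "1 + y - inverse (1 + y) = y * (1 + inverse (1 + y))" by algebra
  hence eq: "1 + y - 1 / (1 + y) = y * (1 + 1 / (1 + y))" by (simp only: divide_inverse mult_1_left)
  show ?thesis
    unfolding phase_def[abs_def] eq[symmetric] using assms
    by (auto intro!: derivative_eq_intros simp: inverse_eq_divide)
qed

text \<open>The line of integration misses the saddle point by a bounded distance. The point \<open>x\<close> is
  compared with its projection to the parallel line through \<open>\<xi>\<close>.\<close>

lemma phase_le_near_saddle:
  fixes \<xi> x :: complex and \<sigma> :: real
  defines "c \<equiv> pi * min (1 / 20) (\<sigma>\<^sup>2 / 2)" and "B \<equiv> pi * (1 + 2 / \<sigma>)"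
  assumes "0 < \<sigma>" "1 \<le> norm \<xi>" and Arg: "- (3 * pi / 4) < Arg \<xi>" "Arg \<xi> < pi / 4"
    and sin: "\<sigma> \<le> sin (pi / 4 - Arg \<xi>)"
    and d: "\<bar>(Re x - Im x) - (Re \<xi> - Im \<xi>)\<bar> \<le> 1 / 2" "(Re \<xi> - Im \<xi>) / 2 \<le> Re x - Im x"
  shows "Re (phase \<xi> (x / \<xi> - 1)) \<le> c + B\<^sup>2 / (4 * c) + B / 2 - c * (norm (x - \<xi>))\<^sup>2"
proof -
  \<comment> \<open>Coordinates adapted to the line through \<xi>: \<open>r\<close> locates the
    projection on it, and \<eta> is the signed distance from it.\<close>
  define z where "z = (x - \<xi>) * cis (- (pi / 4))"
  define r \<eta> where "r = Re z" and "\<eta> = Im z"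
  have c: "0 < c" using \<open>0 < \<sigma>\<close> by (simp add: c_def)
  have xz: "x = \<xi> + z * cis (pi / 4)" by (simp add: z_def mult.assoc cis_mult)
  have \<xi>0: "\<xi> \<noteq> 0" using assms(4) by auto
  have \<eta>: "\<bar>\<eta>\<bar> \<le> 1 / 2"
  proof -
    have "(Re x - Im x) - (Re \<xi> - Im \<xi>) = - sqrt 2 * \<eta>"
      by (simp add: xz cos_45 sin_45 \<eta>_def algebra_simps)
    hence "sqrt 2 * \<bar>\<eta>\<bar> \<le> 1 / 2" using d(1) by (simp add: abs_mult)
    moreover have "1 * \<bar>\<eta>\<bar> \<le> sqrt 2 * \<bar>\<eta>\<bar>" by (intro mult_right_mono) auto
    ultimately show ?thesis by simp
  qed
  have nz: "(norm (x - \<xi>))\<^sup>2 = r\<^sup>2 + \<eta>\<^sup>2"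
    by (simp add: xz norm_mult r_def \<eta>_def cmod_power2)
  define u u' where "u = x / \<xi> - 1" and "u' = of_real r * cis (pi / 4) / \<xi>"
  have uu: "norm (u - u') = \<bar>\<eta>\<bar> / norm \<xi>"
  proof -
    have "u - u' = (z - of_real r) * cis (pi / 4) / \<xi>"
      using \<xi>0 by (simp add: u_def u'_def xz field_simps)
    also have "z - of_real r = \<i> * of_real \<eta>" by (simp add: r_def \<eta>_def complex_eq_iff)
    finally show ?thesis by (simp add: norm_mult norm_divide)
  qed
  have dge: "sqrt 2 * norm \<xi> * \<sigma> \<le> Re \<xi> - Im \<xi>"
    unfolding Re_minus_Im_eq[of \<xi>] by (rule mult_left_mono[OF sin]) simp
  have "0 < sqrt 2 * norm \<xi> * \<sigma>" using \<open>0 < \<sigma>\<close> \<xi>0 by simp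
  with dge have dpos: "0 < Re \<xi> - Im \<xi>" by linarith
  \<comment> \<open>Convexity keeps the segment from the projection to the point in a half-plane
    away from the cut. This gives both differentiability of the logarithm and
    \<open>\<sigma> / 2 \<le> norm (1 + y)\<close>.\<close>
  have half: "(Re \<xi> - Im \<xi>) / 2 \<le> Re (\<xi> * (1 + y)) - Im (\<xi> * (1 + y))" if "y \<in> closed_segment u' u" for y
  proof -
    from that have "\<exists>t. 0 \<le> t \<and> t \<le> 1 \<and> y = (1 - t) *\<^sub>R u' + t *\<^sub>R u"
      by (simp only: in_segment(1))
    then obtain t where t: "0 \<le> t" "t \<le> 1" "y = (1 - t) *\<^sub>R u' + t *\<^sub>R u"
      by (elim exE conjE)
    have "\<xi> * (1 + y) = \<xi> + of_real (1 - t) * (\<xi> * u') + of_real t * (\<xi> * u)"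
      by (simp add: t(3) scaleR_conv_of_real algebra_simps)
    also have "\<xi> * u = x - \<xi>" using \<xi>0 by (simp add: u_def field_simps)
    also have "\<xi> * u' = of_real r * cis (pi / 4)" using \<xi>0 by (simp add: u'_def)
    finally have "Re (\<xi> * (1 + y)) - Im (\<xi> * (1 + y)) = (1 - t) * (Re \<xi> - Im \<xi>) + t * (Re x - Im x)"
    proof (rule ssubst)
      have "cos (pi / 4) = sin (pi / 4)" by (simp add: cos_45 sin_45)
      thus "Re (\<xi> + of_real (1 - t) * (of_real r * cis (pi / 4)) + of_real t * (x - \<xi>))
        - Im (\<xi> + of_real (1 - t) * (of_real r * cis (pi / 4)) + of_real t * (x - \<xi>))
        = (1 - t) * (Re \<xi> - Im \<xi>) + t * (Re x - Im x)" by (simp add: algebra_simps)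
    qed
    moreover have "(1 - t) * ((Re \<xi> - Im \<xi>) / 2) \<le> (1 - t) * (Re \<xi> - Im \<xi>)"
      using t dpos by (intro mult_left_mono) auto
    moreover have "t * ((Re \<xi> - Im \<xi>) / 2) \<le> t * (Re x - Im x)"
      using t d by (intro mult_left_mono) auto
    moreover have "(1 - t) * ((Re \<xi> - Im \<xi>) / 2) + t * ((Re \<xi> - Im \<xi>) / 2) = (Re \<xi> - Im \<xi>) / 2"
      by (simp only: distrib_right[symmetric]) simp
    ultimately show ?thesis by linarith
  qed
  \<comment> \<open>The derivative is of order \<open>norm \<xi> * (|r| + 1)\<close> and the
    displacement at most \<open>1 / (2 * norm \<xi>)\<close>, so the exponent changes by an amount
    linear in \<open>|r|\<close>, whatever the size of \<xi>.\<close>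
  have "norm (phase \<xi> u - phase \<xi> u') \<le> 2 * pi * norm \<xi> * (\<bar>r\<bar> + 1 / 2) * (1 + 2 / \<sigma>) * norm (u - u')"
  proof (rule field_differentiable_bound[where S = "closed_segment u' u"])
    fix y assume y: "y \<in> closed_segment u' u"
    show "(phase \<xi> has_field_derivative 2 * pi * \<i> * \<xi>\<^sup>2 * (y * (1 + 1 / (1 + y)))) (at y within closed_segment u' u)"
    proof (rule phase_deriv, rule notI)
      assume "1 + y \<in> \<real>\<^sub>\<le>\<^sub>0"
      then obtain k where k: "1 + y = of_real k" "k \<le> 0" by (elim nonpos_Reals_cases)
      have "Re (\<xi> * (1 + y)) - Im (\<xi> * (1 + y)) = k * (Re \<xi> - Im \<xi>)" by (simp add: k algebra_simps)
      also have "\<dots> \<le> 0" using k dpos by (simp add: mult_nonpos_nonneg)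
      finally have "(Re \<xi> - Im \<xi>) / 2 \<le> 0" using half[OF y] order_trans by blast
      thus False using dpos by simp
    qed
    have "sqrt 2 * norm \<xi> * \<sigma> / 2 \<le> sqrt 2 * norm (\<xi> * (1 + y))"
      by (rule order_trans[OF divide_right_mono[OF dge] order_trans[OF half[OF y] norm_ge_Re_minus_Im]]) simp
    hence "\<sigma> / 2 \<le> norm (1 + y)" using \<xi>0 by (simp add: norm_mult)
    hence "norm (1 / (1 + y)) \<le> 1 / (\<sigma> / 2)"
      unfolding norm_divide norm_one using \<open>0 < \<sigma>\<close> by (intro divide_left_mono mult_pos_pos) auto
    hence 1: "norm (1 + 1 / (1 + y)) \<le> 1 + 2 / \<sigma>"
      using norm_triangle_ineq[of 1 "1 / (1 + y)"] by simp
    have "norm (y - u') \<le> norm (u - u')"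
      using segment_bound(1)[OF y] by (simp add: norm_minus_commute)
    hence "norm y \<le> norm u' + norm (u - u')"
      using norm_triangle_ineq[of u' "y - u'"] by simp
    also have "\<dots> = (\<bar>r\<bar> + \<bar>\<eta>\<bar>) / norm \<xi>" unfolding uu by (simp add: u'_def norm_mult norm_divide add_divide_distrib)
    also have "\<dots> \<le> (\<bar>r\<bar> + 1 / 2) / norm \<xi>" using \<eta> by (intro divide_right_mono) auto
    finally have 2: "norm y \<le> (\<bar>r\<bar> + 1 / 2) / norm \<xi>" .
    have "norm (2 * pi * \<i> * \<xi>\<^sup>2 * (y * (1 + 1 / (1 + y)))) = 2 * pi * (norm \<xi>)\<^sup>2 * (norm y * norm (1 + 1 / (1 + y)))"
      by (simp add: norm_mult norm_power)
    also have "\<dots> \<le> 2 * pi * (norm \<xi>)\<^sup>2 * ((\<bar>r\<bar> + 1 / 2) / norm \<xi> * (1 + 2 / \<sigma>))"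
      using 1 2 by (intro mult_left_mono mult_mono) auto
    also have "\<dots> = 2 * pi * norm \<xi> * (\<bar>r\<bar> + 1 / 2) * (1 + 2 / \<sigma>)"
      using \<xi>0 by (simp add: power2_eq_square)
    finally show "norm (2 * pi * \<i> * \<xi>\<^sup>2 * (y * (1 + 1 / (1 + y)))) \<le> 2 * pi * norm \<xi> * (\<bar>r\<bar> + 1 / 2) * (1 + 2 / \<sigma>)" .
  qed auto
  also have "\<dots> \<le> 2 * pi * norm \<xi> * (\<bar>r\<bar> + 1 / 2) * (1 + 2 / \<sigma>) * (1 / 2 / norm \<xi>)"
    unfolding uu using \<eta> \<open>0 < \<sigma>\<close> by (intro mult_left_mono divide_right_mono) auto
  also have "\<dots> = B * (\<bar>r\<bar> + 1 / 2)" using \<xi>0 by (simp add: B_def)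
  finally have "Re (phase \<xi> u) - Re (phase \<xi> u') \<le> B * (\<bar>r\<bar> + 1 / 2)"
    using complex_Re_le_cmod[of "phase \<xi> u - phase \<xi> u'"] by simp
  \<comment> \<open>Twice \<open>c\<close> is available here: one half absorbs the linear term
    \<open>B * |r|\<close>, the other is the decay in the conclusion.\<close>
  moreover have "Re (phase \<xi> u') \<le> - (2 * c) * r\<^sup>2"
  proof -
    define m where "m = min (1 / 20) ((sin (pi / 4 - Arg \<xi>))\<^sup>2 / 2)"
    have "\<sigma>\<^sup>2 \<le> (sin (pi / 4 - Arg \<xi>))\<^sup>2" using sin \<open>0 < \<sigma>\<close> by (intro power_mono) auto
    hence "c \<le> pi * m"
      unfolding c_def m_def by (intro mult_left_mono min.mono) auto
    hence "- (2 * (pi * m)) * r\<^sup>2 \<le> - (2 * c) * r\<^sup>2" by (intro mult_right_mono) auto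
    moreover have "Re (phase \<xi> u') \<le> - (2 * (pi * m)) * r\<^sup>2"
      using phase_le_through_saddle[OF \<xi>0 Arg, of r] unfolding u'_def m_def[symmetric] by (simp only: mult.assoc)
    ultimately show ?thesis by (rule order_trans[rotated])
  qed
  moreover have "B * \<bar>r\<bar> \<le> c * r\<^sup>2 + B\<^sup>2 / (4 * c)"
  proof -
    have "0 \<le> (2 * c * \<bar>r\<bar> - B)\<^sup>2 / (4 * c)" using c by simp
    also have "\<dots> = c * r\<^sup>2 - B * \<bar>r\<bar> + B\<^sup>2 / (4 * c)" using c by (simp add: power2_diff field_simps power2_eq_square)
    finally show ?thesis by simp
  qed
  moreover have "c * (norm (x - \<xi>))\<^sup>2 \<le> c * r\<^sup>2 + c"
  proof -
    have "\<eta>\<^sup>2 \<le> 1\<^sup>2" using \<eta> by (intro abs_le_square_iff[THEN iffD1]) auto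
    hence "c * (r\<^sup>2 + \<eta>\<^sup>2) \<le> c * (r\<^sup>2 + 1)" using c by (intro mult_left_mono) auto
    thus ?thesis by (simp add: nz distrib_left)
  qed
  ultimately show ?thesis unfolding u_def[symmetric] by (simp add: algebra_simps)
qed

subsection \<open>The saddle point and the line of integration\<close>

abbreviation dir :: complex where "dir \<equiv> cis (- (3 * pi / 4))"

lemma cos_135: "cos (3 * pi / 4) = - 1 / sqrt 2" and sin_135: "sin (3 * pi / 4) = 1 / sqrt 2"
  using arg_cong[OF cis_135, of Re] arg_cong[OF cis_135, of Im] by simp_all

text \<open>\<open>Arg (saddle s) = (Arg s - pi / 2) / 2\<close>, so
  \<open>pi / 4 - Arg (saddle s) = pi / 2 - Arg s / 2\<close> lies between
  \<open>\<theta> / 2\<close> and \<open>pi - \<theta> / 2\<close>. The lower bound for its sine is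
  what brings \<theta> into the constants.\<close>

lemma sector_saddle:
  assumes "0 < \<theta>" "s \<in> sector \<theta>"
  shows "(saddle s)\<^sup>2 = s / (2 * pi * \<i>)" "1 \<le> norm (saddle s)"
    "- (3 * pi / 4) < Arg (saddle s)" "Arg (saddle s) < pi / 4"
    "sin (\<theta> / 2) \<le> sin (pi / 4 - Arg (saddle s))"
proof -
  have s: "- pi + \<theta> \<le> Arg s" "Arg s \<le> pi - \<theta>" "2 * pi \<le> norm s" using assms(2) by (auto simp: sector_def)
  have "- pi < Arg s" "Arg s < pi" using s assms(1) by auto
  note sc = saddle_correct[OF this]
  show 1: "(saddle s)\<^sup>2 = s / (2 * pi * \<i>)" "- (3 * pi / 4) < Arg (saddle s)" "Arg (saddle s) < pi / 4"
    by (fact sc)+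
  have "(norm (saddle s))\<^sup>2 = norm s / (2 * pi)"
    unfolding norm_power[symmetric] 1(1) by (simp add: norm_divide norm_mult)
  also have "1\<^sup>2 \<le> \<dots>" using s(3) by (simp add: field_simps)
  finally show n1: "1 \<le> norm (saddle s)" by (rule power2_le_imp_le) simp
  define w where "w = rcis (norm (saddle s)) ((Arg s - pi / 2) / 2)"
  have "w\<^sup>2 = rcis ((norm (saddle s))\<^sup>2) (Arg s - pi / 2)"
    by (simp add: w_def DeMoivre2 diff_divide_distrib)
  also have "\<dots> = rcis (norm s) (Arg s) / (2 * pi * \<i>)"
    unfolding rcis_def cis_divide[symmetric] cis_pi_half \<open>(norm (saddle s))\<^sup>2 = norm s / (2 * pi)\<close>
    by (simp add: divide_simps mult.left_commute[of \<i>])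
  also have "\<dots> = s / (2 * pi * \<i>)" by (simp add: rcis_cmod_Arg)
  finally have w2: "w\<^sup>2 = s / (2 * pi * \<i>)" .
  have "0 < norm (saddle s)" using n1 by linarith
  hence A: "Arg w = (Arg s - pi / 2) / 2"
    unfolding w_def rcis_def using s assms(1)
    by (intro cis_Arg_unique) (auto simp: sgn_mult sgn_of_real)
  hence "saddle s = w" using w2 s assms(1) by (intro saddle_eqI) auto
  hence "pi / 4 - Arg (saddle s) = pi / 2 - Arg s / 2" using A by (simp add: field_simps)
  hence "sin (pi / 4 - Arg (saddle s)) = cos \<bar>Arg s / 2\<bar>" by (simp only: cos_abs_real) (simp add: sin_diff)
  also have "\<dots> \<ge> cos (pi / 2 - \<theta> / 2)" using s assms(1) by (intro cos_monotone_0_pi_le) auto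
  finally show "sin (\<theta> / 2) \<le> sin (pi / 4 - Arg (saddle s))" by (simp add: cos_diff)
qed

lemma ell_bounds:
  assumes "0 < \<theta>" "s \<in> sector \<theta>"
  shows "real (ell s) \<le> Re (saddle s) - Im (saddle s)" "Re (saddle s) - Im (saddle s) < real (ell s) + 1"
proof -
  have "- pi < Arg s" "Arg s < pi" using assms by (auto simp: sector_def)
  from saddle_Re_minus_Im_nonneg[OF this]
  show "real (ell s) \<le> Re (saddle s) - Im (saddle s)" "Re (saddle s) - Im (saddle s) < real (ell s) + 1"
    unfolding ell_def by linarith+
qed

section \<open>Size of the Gaussian and of the cosine on the line of integration\<close>

definition disp :: "complex \<Rightarrow> real \<Rightarrow> complex" where
  "disp q t = of_real t * dir - q"

text \<open>\<open>disp q t\<close> has component \<open>t + \<mu> q\<close> along the line and, up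
  to sign, \<open>(Re q - Im q) / sqrt 2\<close> across it. The modulus of the exponential depends
  on the product of real and imaginary part, which is half the squared norm up to this bounded
  transverse part.\<close>

lemma norm_disp:
  defines "\<mu> \<equiv> \<lambda>q. (Re q + Im q) / sqrt 2"
  assumes "\<bar>Re q - Im q\<bar> \<le> 1"
  shows "\<bar>t + \<mu> q\<bar> \<le> norm (disp q t)" "norm (disp q t) \<le> 1 + \<bar>t + \<mu> q\<bar>"
    "norm (exp (pi * \<i> / 2 * (disp q t)\<^sup>2)) \<le> exp (pi / 2 - pi / 2 * (norm (disp q t))\<^sup>2)"
proof -
  define z where "z = disp q t"
  define \<nu> where "\<nu> = Re q - Im q"
  have z: "Re z = - t / sqrt 2 - Re q" "Im z = - t / sqrt 2 - Im q"
    by (simp_all add: z_def disp_def cos_135 sin_135)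
  have sum: "Re z + Im z = - sqrt 2 * (t + \<mu> q)"
    by (simp add: z \<mu>_def field_simps)
  have diff: "Re z - Im z = - \<nu>" by (simp add: z \<nu>_def)
  have n: "2 * (norm z)\<^sup>2 = (Re z + Im z)\<^sup>2 + (Re z - Im z)\<^sup>2"
    by (simp add: cmod_power2 power2_sum power2_diff)
  have nsq: "(norm z)\<^sup>2 = (t + \<mu> q)\<^sup>2 + \<nu>\<^sup>2 / 2"
    using n unfolding sum diff by (simp add: power_mult_distrib)
  have \<nu>: "\<nu>\<^sup>2 \<le> 1" using assms(2) abs_le_square_iff[of \<nu> 1] by (simp add: \<nu>_def)
  have "(t + \<mu> q)\<^sup>2 \<le> (norm z)\<^sup>2" by (simp add: nsq)
  thus "\<bar>t + \<mu> q\<bar> \<le> norm (disp q t)" unfolding z_def by (simp add: abs_le_square_iff[symmetric])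
  have "(norm z)\<^sup>2 \<le> (1 + \<bar>t + \<mu> q\<bar>)\<^sup>2"
  proof -
    have "(1 + \<bar>t + \<mu> q\<bar>)\<^sup>2 = 1 + 2 * \<bar>t + \<mu> q\<bar> + (t + \<mu> q)\<^sup>2" by (subst power2_sum) simp
    moreover have "N \<le> P" if "P = 1 + 2 * a + b" "v \<le> 1" "0 \<le> a" "N = b + v / 2" for N P a b v :: real
      using that by linarith
    ultimately show ?thesis using \<nu> abs_ge_zero nsq by blast
  qed
  thus "norm (disp q t) \<le> 1 + \<bar>t + \<mu> q\<bar>" unfolding z_def by (rule power2_le_imp_le) simp
  have "4 * (Re z * Im z) = (Re z + Im z)\<^sup>2 - (Re z - Im z)\<^sup>2" by (simp add: power2_sum power2_diff)
  hence "2 * (Re z * Im z) = (norm z)\<^sup>2 - \<nu>\<^sup>2" using n unfolding diff by simp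
  hence "(norm z)\<^sup>2 - 1 \<le> 2 * (Re z * Im z)" using \<nu> by linarith
  hence "pi / 2 * ((norm z)\<^sup>2 - 1) \<le> pi / 2 * (2 * (Re z * Im z))" by (rule mult_left_mono) simp
  hence "- (pi * (Re z * Im z)) \<le> pi / 2 - pi / 2 * (norm z)\<^sup>2" by (simp add: right_diff_distrib)
  moreover have "Re (pi * \<i> / 2 * z\<^sup>2) = - (pi * (Re z * Im z))" by (simp add: power2_eq_square)
  ultimately show "norm (exp (pi * \<i> / 2 * (disp q t)\<^sup>2)) \<le> exp (pi / 2 - pi / 2 * (norm (disp q t))\<^sup>2)"
    unfolding z_def[symmetric] norm_exp_eq_Re by simp
qed

text \<open>The argument is \<open>y + \<i> * y\<close>, so the squared modulus is
  \<open>(cos y)^2 + (sinh y)^2\<close>. It is at least 1 because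
  \<open>|sin y| \<le> |sinh y|\<close>, and \<open>exp |y| \<le> 2 * |sinh y| + 1\<close> gives the
  constant 3.\<close>

lemma norm_cos_line_ge: "exp (pi / (2 * sqrt 2) * \<bar>t\<bar>) \<le> 3 * norm (cos (pi * (of_real t * dir) / 2))"
proof -
  define y where "y = - (pi * t / (2 * sqrt 2))"
  define S where "S = (exp y - inverse (exp y)) / 2"
  define n where "n = norm (cos (pi * (of_real t * dir) / 2))"
  have "Re (pi * (of_real t * dir) / 2) = y" "Im (pi * (of_real t * dir) / 2) = y"
    by (simp_all add: y_def cos_135 sin_135)
  hence n2: "n\<^sup>2 = (cos y)\<^sup>2 + S\<^sup>2" unfolding n_def norm_cos_squared by (simp add: S_def power_divide)
  have "\<bar>sin y\<bar> \<le> \<bar>S\<bar>"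
    using abs_sin_x_le_abs_x[of y] real_le_abs_sinh[of y] by (simp add: S_def)
  hence "(sin y)\<^sup>2 \<le> S\<^sup>2" by (simp add: abs_le_square_iff)
  hence "1 \<le> n\<^sup>2" using sin_cos_squared_add[of y] unfolding n2 by linarith
  hence "1\<^sup>2 \<le> n\<^sup>2" by simp
  hence n1: "1 \<le> n" by (rule power2_le_imp_le) (simp add: n_def)
  have "\<bar>S\<bar>\<^sup>2 \<le> n\<^sup>2" by (simp add: n2)
  hence nS: "\<bar>S\<bar> \<le> n" by (rule power2_le_imp_le) (simp add: n_def)
  have "exp \<bar>y\<bar> \<le> 2 * \<bar>S\<bar> + 1"
  proof (cases "0 \<le> y")
    case True
    hence "inverse (exp y) \<le> 1" by (simp add: exp_minus[symmetric])
    thus ?thesis using True unfolding S_def by simp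
  next
    case False
    hence "exp y \<le> 1" "1 \<le> exp (- y)" by simp_all
    hence "exp y \<le> inverse (exp y)" unfolding exp_minus by (rule order_trans)
    hence "\<bar>S\<bar> = (inverse (exp y) - exp y) / 2" by (simp add: S_def)
    hence "2 * \<bar>S\<bar> = inverse (exp y) - exp y" by simp
    moreover have "exp \<bar>y\<bar> = inverse (exp y)" using False by (simp add: exp_minus)
    ultimately show ?thesis using \<open>exp y \<le> 1\<close> by linarith
  qed
  moreover have "\<bar>y\<bar> = pi / (2 * sqrt 2) * \<bar>t\<bar>" by (simp add: y_def abs_mult)
  ultimately show ?thesis using n1 nS unfolding n_def by simp
qed

text \<open>The factor shared by the exact integrand and the integrands of all
  \<open>DD k\<close>.\<close>

definition gauss_kernel :: "complex \<Rightarrow> real \<Rightarrow> complex" where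
  "gauss_kernel q t = exp (pi * \<i> / 2 * (disp q t)\<^sup>2) / (2 * cos (pi * (of_real t * dir) / 2))"

lemma norm_gauss_kernel_mult_le:
  assumes "norm (exp (pi * \<i> / 2 * (disp q t)\<^sup>2) * w) \<le> b"
  shows "norm (gauss_kernel q t * w) \<le> 2 * exp (- (pi / (2 * sqrt 2) * \<bar>t\<bar>)) * b"
proof -
  define n where "n = norm (cos (pi * (of_real t * dir) / 2))"
  define p where "p = pi / (2 * sqrt 2) * \<bar>t\<bar>"
  have "exp p \<le> 3 * n" unfolding n_def p_def by (rule norm_cos_line_ge)
  hence *: "exp p / 2 \<le> 2 * n" and "0 < n" using exp_gt_zero[of p] by (simp_all, linarith+)
  have "norm (gauss_kernel q t * w) = norm (exp (pi * \<i> / 2 * (disp q t)\<^sup>2) * w) / (2 * n)"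
    by (simp add: gauss_kernel_def n_def norm_mult norm_divide)
  also have "\<dots> \<le> b / (exp p / 2)"
    using assms * order_trans[OF norm_ge_zero assms] by (intro frac_le) auto
  also have "\<dots> = 2 * exp (- p) * b" by (simp add: exp_minus field_simps)
  finally show ?thesis by (simp add: p_def)
qed

text \<open>The saddle point obeys the same bounds. Two arguments in an open interval of length
  \<open>pi\<close> differ by less than \<open>pi\<close>, so \<open>Ln x - Ln \<xi>\<close> is
  again a principal logarithm.\<close>

lemma Arg_half_plane:
  assumes "0 < Re x - Im x"
  shows "- (3 * pi / 4) < Arg x" "Arg x < pi / 4"
proof -
  have "0 < sqrt 2 * norm x * sin (pi / 4 - Arg x)" using assms by (simp only: Re_minus_Im_eq)
  hence s: "0 < sin (pi / 4 - Arg x)" by (meson mult_pos_pos not_le mult_nonneg_nonpos norm_ge_zero real_sqrt_ge_zero zero_le_numeral mult_nonneg_nonneg)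
  have A: "- pi < Arg x" "Arg x \<le> pi" using Arg_bounded[of x] by auto
  show "Arg x < pi / 4"
  proof (rule ccontr)
    assume "\<not> Arg x < pi / 4"
    hence "0 \<le> sin (Arg x - pi / 4)" using A by (intro sin_ge_zero) auto
    thus False using s sin_minus[of "Arg x - pi / 4"] by simp
  qed
  show "- (3 * pi / 4) < Arg x"
  proof (rule ccontr)
    assume "\<not> - (3 * pi / 4) < Arg x"
    hence "0 \<le> sin (- (3 * pi / 4) - Arg x)" using A by (intro sin_ge_zero) auto
    also have "- (3 * pi / 4) - Arg x = (pi / 4 - Arg x) - pi" by simp
    also have "sin \<dots> = - sin (pi / 4 - Arg x)" by (rule sin_minus_pi)
    finally show False using s by simp
  qed
qed

text \<open>Shifting by a half-integer turns the sine of the denominator into a cosine; the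
  prefactor \<open>(- 1) ^ ell s / (2 * \<i>)\<close> originates here.\<close>

lemma sin_half_shift:
  "exp (pi * \<i> * (of_nat n + 1 / 2 + v / 2)) - exp (- (pi * \<i> * (of_nat n + 1 / 2 + v / 2)))
     = 2 * \<i> * (- 1) ^ n * cos (pi * v / 2)" for v :: complex
proof -
  define e where "e = exp (pi * \<i> * v / 2)"
  have n: "exp (pi * \<i> * of_nat n) = (- 1) ^ n"
    using exp_of_nat_mult[of n "pi * \<i>"] by (simp add: mult_ac)
  have h: "exp (pi * \<i> * (1 / 2)) = \<i>" using cis_pi_half by (simp add: cis_conv_exp mult_ac)
  have sq: "(- 1) ^ n * (- 1) ^ n = (1 :: complex)" by (simp flip: power_add)
  have "exp (pi * \<i> * (of_nat n + 1 / 2 + v / 2)) = exp (pi * \<i> * of_nat n) * exp (pi * \<i> * (1 / 2)) * e"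
    unfolding e_def exp_add[symmetric] by (simp add: algebra_simps)
  also have "\<dots> = (- 1) ^ n * \<i> * e" by (simp only: n h)
  finally have 1: "exp (pi * \<i> * (of_nat n + 1 / 2 + v / 2)) = (- 1) ^ n * \<i> * e" .
  have 2: "exp (- (pi * \<i> * (of_nat n + 1 / 2 + v / 2))) = (- 1) ^ n * (- \<i>) * inverse e"
    unfolding exp_minus 1 by (cases "even n") simp_all
  have c: "cos (pi * v / 2) = (e + inverse e) / 2"
    unfolding cos_exp_eq e_def exp_minus[symmetric] by (simp add: mult_ac)
  show ?thesis unfolding 1 2 c by (simp add: algebra_simps)
qed

text \<open>The substitution \<open>x = ell s + 1 / 2 + v / 2\<close> turns the phase of the integrand into the
  exponent of the generating function.\<close>

lemma saddle_line_integrand: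
  fixes t :: real and s \<xi> D x \<tau> z :: complex
  assumes "0 < \<theta>" "s \<in> sector \<theta>"
  defines "\<xi> \<equiv> saddle s" and "D \<equiv> disp (qq s) t"
  defines "x \<equiv> of_nat (ell s) + 1 / 2 + of_real t * dir / 2"
    and "\<tau> \<equiv> - (1 / (4 * sqrt pi * \<xi>))" and "z \<equiv> \<i> * sqrt pi * D"
  shows "x - \<xi> = D / 2"
    and "exp (pi * \<i> / 2 * D\<^sup>2) * gen_fun \<tau> z = exp (phase \<xi> (x / \<xi> - 1))"
    and "aux_integrand s x / 2 = (- 1) ^ ell s / (2 * \<i>) * \<xi> powr (- s) * exp (pi * \<i> * \<xi>\<^sup>2) * (gauss_kernel (qq s) t * gen_fun \<tau> z)"
proof -
  note sd = sector_saddle[OF assms(1,2), folded \<xi>_def]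
  have \<xi>0: "\<xi> \<noteq> 0" using sd(2) by auto
  show xD: "x - \<xi> = D / 2"
    by (simp add: x_def D_def disp_def qq_def \<xi>_def field_simps)
  define u where "u = x / \<xi> - 1"
  have xu: "x = \<xi> * (1 + u)" and Du: "D = 2 * \<xi> * u" using \<xi>0 xD by (simp_all add: u_def field_simps)
  have spi: "complex_of_real (sqrt pi) * complex_of_real (sqrt pi) = of_real pi"
    by (simp flip: of_real_mult)
  have sp0: "complex_of_real (sqrt pi) \<noteq> 0" by simp
  have \<tau>0: "\<tau> \<noteq> 0" using \<xi>0 by (simp add: \<tau>_def)
  have itz: "2 * \<i> * \<tau> * z = u"
    unfolding \<tau>_def z_def Du using \<xi>0 sp0 by (simp add: field_simps)
  have t2: "\<i> / (8 * \<tau>\<^sup>2) = 2 * pi * \<i> * \<xi>\<^sup>2"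
    unfolding \<tau>_def using \<xi>0 spi by (simp add: power2_eq_square field_simps)
  have "pi * \<i> / 2 * D\<^sup>2 + - (\<i> / (8 * \<tau>\<^sup>2)) * (Ln (1 + u) - u + u\<^sup>2 / 2) = phase \<xi> u"
    unfolding t2 phase_def Du by (simp add: power2_eq_square algebra_simps)
  thus g: "exp (pi * \<i> / 2 * D\<^sup>2) * gen_fun \<tau> z = exp (phase \<xi> (x / \<xi> - 1))"
    unfolding gen_fun_eq[OF \<tau>0] itz exp_add[symmetric] u_def[symmetric] by simp
  have "Re x - Im x = real (ell s) + 1 / 2" by (simp add: x_def cos_135 sin_135)
  hence xpos: "0 < Re x - Im x" by simp
  hence x0: "x \<noteq> 0" by auto
  have Lu: "Ln (1 + u) = Ln x - Ln \<xi>"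
  proof (rule Ln_unique)
    show "exp (Ln x - Ln \<xi>) = 1 + u" using x0 \<xi>0 by (simp add: exp_diff u_def)
    show "- pi < Im (Ln x - Ln \<xi>)" "Im (Ln x - Ln \<xi>) \<le> pi"
      using Arg_half_plane[OF xpos] sd(3,4) x0 \<xi>0 by (simp_all add: Arg_eq_Im_Ln)
  qed
  have s: "s = 2 * pi * \<i> * \<xi>\<^sup>2" using sd(1) by simp
  have "- s * Ln x + pi * \<i> * x\<^sup>2 = - s * Ln \<xi> + pi * \<i> * \<xi>\<^sup>2 + phase \<xi> u"
    unfolding phase_def Lu s xu by (simp add: power2_eq_square algebra_simps)
  hence "exp (- s * Ln x) * exp (pi * \<i> * x\<^sup>2) = exp (- s * Ln \<xi>) * exp (pi * \<i> * \<xi>\<^sup>2) * exp (phase \<xi> u)"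
    by (metis exp_add)
  hence num: "x powr (- s) * exp (pi * \<i> * x\<^sup>2) = \<xi> powr (- s) * exp (pi * \<i> * \<xi>\<^sup>2) * (exp (pi * \<i> / 2 * D\<^sup>2) * gen_fun \<tau> z)"
    using x0 \<xi>0 unfolding g by (simp add: powr_def u_def)
  have den: "exp (pi * \<i> * x) - exp (- (pi * \<i> * x)) = 2 * \<i> * (- 1) ^ ell s * cos (pi * (of_real t * dir) / 2)"
    unfolding x_def by (rule sin_half_shift)
  \<comment> \<open>For \<open>C = 0\<close> both sides are 0, as quotients by 0.\<close>
  have "A * (G * g) / (2 * \<i> * (- 1) ^ n * C) / 2 = (- 1) ^ n / (2 * \<i>) * A * (G / (2 * C) * g)" for A C G g :: complex and n
    by (cases "C = 0"; cases "even n") (simp_all add: field_simps)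
  from this[of "\<xi> powr (- s) * exp (pi * \<i> * \<xi>\<^sup>2)" "exp (pi * \<i> / 2 * D\<^sup>2)" "gen_fun \<tau> z" "ell s" "cos (pi * (of_real t * dir) / 2)"]
  show "aux_integrand s x / 2 = (- 1) ^ ell s / (2 * \<i>) * \<xi> powr (- s) * exp (pi * \<i> * \<xi>\<^sup>2) * (gauss_kernel (qq s) t * gen_fun \<tau> z)"
    unfolding aux_integrand_def gauss_kernel_def D_def[symmetric] num den by (simp only: mult.assoc)
qed

subsection \<open>The remainder\<close>

text \<open>Chosen so that \<open>\<i> / (8 * \<tau>^2) = 2 * pi * \<i> * \<xi>^2\<close>. Its
  powers split into the constant in front of \<open>DD k\<close> and the negative power of \<xi> in
  the expansion.\<close>

definition saddle_tau :: "complex \<Rightarrow> complex" where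
  "saddle_tau s = - (1 / (4 * sqrt pi * saddle s))"

definition gen_arg :: "complex \<Rightarrow> real \<Rightarrow> complex" where
  "gen_arg q t = \<i> * sqrt pi * disp q t"

definition remainder :: "nat \<Rightarrow> complex \<Rightarrow> real \<Rightarrow> complex" where
  "remainder K s t = gen_fun (saddle_tau s) (gen_arg (qq s) t)
     - (\<Sum>k\<le>K. PP k (gen_arg (qq s) t) * saddle_tau s ^ k)"

lemma qq_Re_minus_Im:
  assumes "0 < \<theta>" "s \<in> sector \<theta>"
  shows "\<bar>Re (qq s) - Im (qq s)\<bar> \<le> 1"
proof -
  have "Re (qq s) - Im (qq s) = 2 * (Re (saddle s) - Im (saddle s) - real (ell s)) - 1"
    by (simp add: qq_def algebra_simps)
  moreover have "\<bar>x\<bar> \<le> 1" if "x = 2 * (d - l) - 1" "l \<le> d" "d < l + 1" for x d l :: real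
    unfolding abs_le_iff using that by argo
  ultimately show ?thesis using ell_bounds[OF assms] by blast
qed

lemma norm_gen_arg: "(norm (gen_arg q t))\<^sup>2 / 4 = pi / 4 * (norm (disp q t))\<^sup>2"
  by (simp add: gen_arg_def norm_mult power_mult_distrib)

lemma norm_tau_gen_arg:
  assumes "saddle s \<noteq> 0"
  shows "8 * norm (saddle_tau s * gen_arg q t) = 2 * norm (disp q t) / norm (saddle s)"
  using assms by (simp add: saddle_tau_def gen_arg_def norm_mult norm_divide)

lemma exp_gen_fun_decay:
  assumes "0 < \<theta>" "\<theta> < pi"
  obtains c C where "0 < c"
    "\<And>s t. s \<in> sector \<theta> \<Longrightarrow> norm (exp (pi * \<i> / 2 * (disp (qq s) t)\<^sup>2) * gen_fun (saddle_tau s) (gen_arg (qq s) t))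
        \<le> exp (C - c * (norm (disp (qq s) t))\<^sup>2)"
proof -
  define \<sigma> where "\<sigma> = sin (\<theta> / 2)"
  have \<sigma>: "0 < \<sigma>" unfolding \<sigma>_def using assms by (intro sin_gt_zero) auto
  define c where "c = pi * min (1 / 20) (\<sigma>\<^sup>2 / 2)"
  define B where "B = pi * (1 + 2 / \<sigma>)"
  have c: "0 < c" using \<sigma> by (simp add: c_def)
  show ?thesis
  \<comment> \<open>The divisor 4 in \<open>c / 4\<close> comes from
    \<open>x - saddle s = disp (qq s) t / 2\<close>.\<close>
  proof (rule that[of "c / 4" "c + B\<^sup>2 / (4 * c) + B / 2"])
    show "0 < c / 4" using c by simp
    fix s t assume s: "s \<in> sector \<theta>"
    note sd = sector_saddle[OF assms(1) s] and el = ell_bounds[OF assms(1) s]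
      and sli = saddle_line_integrand[OF assms(1) s, of t, folded saddle_tau_def gen_arg_def]
    define x where "x = of_nat (ell s) + 1 / 2 + of_real t * dir / 2"
    have nonneg: "0 \<le> real (ell s)" by simp
    have xa: "Re x - Im x = real (ell s) + 1 / 2" by (simp add: x_def cos_135 sin_135)
    have "Re (phase (saddle s) (x / saddle s - 1)) \<le> c + B\<^sup>2 / (4 * c) + B / 2 - c * (norm (x - saddle s))\<^sup>2"
      unfolding c_def B_def
    proof (rule phase_le_near_saddle[OF \<sigma> sd(2-4)])
      show "\<sigma> \<le> sin (pi / 4 - Arg (saddle s))" using sd(5) by (simp add: \<sigma>_def)
      \<comment> \<open>With \<open>d = Re (saddle s) - Im (saddle s)\<close> in
        \<open>[ell s, ell s + 1)\<close>, both claims compare \<open>d\<close> with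
        \<open>ell s + 1 / 2\<close>; the second holds even for \<open>ell s = 0\<close>, as
        \<open>d / 2 < 1 / 2\<close>.\<close>
      show "\<bar>(Re x - Im x) - (Re (saddle s) - Im (saddle s))\<bar> \<le> 1 / 2" "(Re (saddle s) - Im (saddle s)) / 2 \<le> Re x - Im x"
        using el nonneg unfolding xa by argo+
    qed
    also have "x - saddle s = disp (qq s) t / 2" unfolding x_def by (rule sli(1))
    finally have "Re (phase (saddle s) (x / saddle s - 1)) \<le> c + B\<^sup>2 / (4 * c) + B / 2 - c / 4 * (norm (disp (qq s) t))\<^sup>2"
      by (simp add: norm_divide power_divide)
    thus "norm (exp (pi * \<i> / 2 * (disp (qq s) t)\<^sup>2) * gen_fun (saddle_tau s) (gen_arg (qq s) t))
        \<le> exp (c + B\<^sup>2 / (4 * c) + B / 2 - c / 4 * (norm (disp (qq s) t))\<^sup>2)"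
      unfolding sli(2) x_def[symmetric] norm_exp_eq_Re by simp
  qed
qed

lemma exp_remainder_le:
  assumes "0 < \<theta>" "\<theta> < pi"
  obtains c C where "0 < c" "0 \<le> C"
    "\<And>s t. s \<in> sector \<theta> \<Longrightarrow> norm (exp (pi * \<i> / 2 * (disp (qq s) t)\<^sup>2) * remainder K s t)
        \<le> C * exp (- (c * (norm (disp (qq s) t))\<^sup>2)) * (norm (disp (qq s) t) / norm (saddle s)) ^ (K + 1)"
proof -
  obtain c1 C1 where c1: "0 < c1"
    and gen: "\<And>s t. s \<in> sector \<theta> \<Longrightarrow> norm (exp (pi * \<i> / 2 * (disp (qq s) t)\<^sup>2) * gen_fun (saddle_tau s) (gen_arg (qq s) t))
        \<le> exp (C1 - c1 * (norm (disp (qq s) t))\<^sup>2)"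
    using exp_gen_fun_decay[OF assms] by metis
  \<comment> \<open>\<open>pi / 4\<close> is what remains of the Gaussian exponent
    \<open>pi / 2\<close> after the factor \<open>exp ((norm z)^2 / 4)\<close>.\<close>
  define c where "c = min c1 (pi / 4)"
  define M where "M = real ((K + 1) * 2 ^ (K + 1))"
  \<comment> \<open>The summands belong to the Taylor remainder near the saddle point and, away from
    it, to the generating function and the Taylor polynomial. The outer power of 2 converts
    \<open>y\<close> into \<open>W / norm (saddle s)\<close>.\<close>
  define C where "C = (2 * exp (pi / 2) + exp C1 * 2 ^ (K + 1) + exp (pi / 2) * M) * 2 ^ (K + 1)"
  show ?thesis
  proof (rule that[of c C])
    show "0 < c" using c1 by (simp add: c_def)
    show "0 \<le> C" unfolding C_def M_def by (intro mult_nonneg_nonneg add_nonneg_nonneg) auto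
    fix s t assume s: "s \<in> sector \<theta>"
    define W where "W = norm (disp (qq s) t)"
    define G where "G = exp (pi * \<i> / 2 * (disp (qq s) t)\<^sup>2)"
    define y where "y = 2 * W / norm (saddle s)"
    define e where "e = exp (- (c * W\<^sup>2))"
    define z where "z = gen_arg (qq s) t"
    have \<xi>: "1 \<le> norm (saddle s)" by (rule sector_saddle(2)[OF assms(1) s])
    hence \<xi>0: "saddle s \<noteq> 0" by auto
    have \<tau>0: "saddle_tau s \<noteq> 0" using \<xi>0 by (simp add: saddle_tau_def)
    have y: "8 * norm (saddle_tau s * z) = y" unfolding z_def y_def W_def by (rule norm_tau_gen_arg[OF \<xi>0])
    have y0: "0 \<le> y" by (simp add: y_def W_def)
    have G: "norm G \<le> exp (pi / 2 - pi / 2 * W\<^sup>2)"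
      unfolding G_def W_def by (rule norm_disp(3)[OF qq_Re_minus_Im[OF assms(1) s]])
    have GG: "norm G * exp ((norm z)\<^sup>2 / 4) \<le> exp (pi / 2) * e"
    proof -
      have "norm G * exp ((norm z)\<^sup>2 / 4) \<le> exp (pi / 2 - pi / 2 * W\<^sup>2) * exp (pi / 4 * W\<^sup>2)"
        using G unfolding z_def norm_gen_arg W_def[symmetric] by (intro mult_right_mono) auto
      also have "\<dots> = exp (pi / 2) * exp (- (pi / 4 * W\<^sup>2))"
        unfolding exp_add[symmetric] by simp
      also have "\<dots> \<le> exp (pi / 2) * e"
      proof -
        have "c * W\<^sup>2 \<le> pi / 4 * W\<^sup>2" by (intro mult_right_mono) (auto simp: c_def)
        thus ?thesis by (simp add: e_def)
      qed
      finally show ?thesis .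
    qed
    have "norm (G * remainder K s t) \<le> (2 * exp (pi / 2) + exp C1 * 2 ^ (K + 1) + exp (pi / 2) * M) * e * y ^ (K + 1)"
    \<comment> \<open>\<open>y\<close> is four times the relative displacement \<open>norm u\<close>
      from the saddle point, so the cases divide at \<open>norm u = 1 / 8\<close>.\<close>
    proof (cases "y \<le> 1 / 2")
      case True
      have "norm (G * remainder K s t) \<le> norm G * (2 * exp ((norm z)\<^sup>2 / 4) * y ^ (K + 1))"
        unfolding norm_mult remainder_def z_def[symmetric] using True y
        by (intro mult_left_mono gen_fun_remainder_le[OF \<tau>0, where z = z and K = K, unfolded y]) auto
      also have "\<dots> = 2 * (norm G * exp ((norm z)\<^sup>2 / 4)) * y ^ (K + 1)" by simp
      also have "\<dots> \<le> 2 * (exp (pi / 2) * e) * y ^ (K + 1)"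
        using GG y0 by (intro mult_right_mono mult_left_mono) auto
      also have "\<dots> = (2 * exp (pi / 2)) * e * y ^ (K + 1)" by simp
      also have "\<dots> \<le> (2 * exp (pi / 2) + exp C1 * 2 ^ (K + 1) + exp (pi / 2) * M) * e * y ^ (K + 1)"
        using y0 by (intro mult_right_mono) (auto simp: M_def e_def add_nonneg_nonneg)
      finally show ?thesis .
    next
      case False
      have "norm (G * gen_fun (saddle_tau s) z) \<le> exp (C1 - c1 * W\<^sup>2)"
        unfolding G_def z_def W_def by (rule gen[OF s])
      also have "\<dots> \<le> exp (C1 - c * W\<^sup>2)" by (auto simp: c_def intro!: mult_right_mono)
      also have "\<dots> = exp C1 * e" by (simp add: e_def exp_diff exp_minus field_simps)
      also have "\<dots> \<le> exp C1 * e * (2 * y) ^ (K + 1)"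
      proof -
        have "1 \<le> (2 * y) ^ (K + 1)" using False by (intro one_le_power) simp
        thus ?thesis by (simp add: e_def)
      qed
      finally have 1: "norm (G * gen_fun (saddle_tau s) z) \<le> exp C1 * 2 ^ (K + 1) * e * y ^ (K + 1)"
        by (simp only: power_mult_distrib mult_ac)
      have "norm (G * (\<Sum>k\<le>K. PP k z * saddle_tau s ^ k)) \<le> norm G * (M * exp ((norm z)\<^sup>2 / 4) * y ^ (K + 1))"
        using PP_partial_sum_le[of "saddle_tau s" z K, unfolded y] False
        unfolding norm_mult M_def by (intro mult_left_mono) (auto simp: algebra_simps)
      also have "\<dots> = M * (norm G * exp ((norm z)\<^sup>2 / 4)) * y ^ (K + 1)" by simp
      also have "\<dots> \<le> M * (exp (pi / 2) * e) * y ^ (K + 1)"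
        using GG y0 by (intro mult_right_mono mult_left_mono) (auto simp: M_def)
      finally have 2: "norm (G * (\<Sum>k\<le>K. PP k z * saddle_tau s ^ k)) \<le> exp (pi / 2) * M * e * y ^ (K + 1)"
        by (simp only: mult_ac)
      have "norm (G * remainder K s t) \<le> norm (G * gen_fun (saddle_tau s) z) + norm (G * (\<Sum>k\<le>K. PP k z * saddle_tau s ^ k))"
        unfolding remainder_def z_def[symmetric] right_diff_distrib by (rule norm_triangle_ineq4)
      also have "\<dots> \<le> exp C1 * 2 ^ (K + 1) * e * y ^ (K + 1) + exp (pi / 2) * M * e * y ^ (K + 1)"
        by (rule add_mono[OF 1 2])
      also have "\<dots> = (exp C1 * 2 ^ (K + 1) + exp (pi / 2) * M) * e * y ^ (K + 1)"
        by (simp only: distrib_right)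
      also have "\<dots> \<le> (2 * exp (pi / 2) + exp C1 * 2 ^ (K + 1) + exp (pi / 2) * M) * e * y ^ (K + 1)"
        using y0 by (intro mult_right_mono) (auto simp: e_def)
      finally show ?thesis .
    qed
    also have "y ^ (K + 1) = 2 ^ (K + 1) * (W / norm (saddle s)) ^ (K + 1)"
      unfolding y_def power_mult_distrib[symmetric] by simp
    finally have "norm (G * remainder K s t) \<le> C * e * (W / norm (saddle s)) ^ (K + 1)"
      unfolding C_def by (simp only: mult_ac)
    thus "norm (exp (pi * \<i> / 2 * (disp (qq s) t)\<^sup>2) * remainder K s t)
        \<le> C * exp (- (c * (norm (disp (qq s) t))\<^sup>2)) * (norm (disp (qq s) t) / norm (saddle s)) ^ (K + 1)"
      unfolding G_def e_def W_def .
  qed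
qed

lemma power_le_exp_mult: "0 \<le> x \<Longrightarrow> x \<le> 1 + y \<Longrightarrow> x ^ n \<le> exp (real n * y)" for x y :: real
  unfolding exp_of_nat_mult using exp_ge_add_one_self[of y] by (intro power_mono) linarith+

definition error_term :: "nat \<Rightarrow> complex \<Rightarrow> complex" where
  "error_term K s = (LBINT t. gauss_kernel (qq s) t * remainder K s t * dir)"

text \<open>Since \<open>\<bar>\<mu>\<bar> \<le> \<bar>t\<bar> + \<bar>t + \<mu>\<bar>\<close>, the decay of the reciprocal cosine yields the factor in \<open>\<mu>\<close>;
  the loss is absorbed by the Gaussian centred at \<open>- \<mu>\<close>.\<close>

lemma norm_error_term_le:
  assumes "0 < \<theta>" "\<theta> < pi"
  obtains C where
    "\<And>s. s \<in> sector \<theta> \<Longrightarrow> norm (error_term K s) \<le> C * (exp (- (pi / (2 * sqrt 2)) * \<bar>mu s\<bar>) / norm (saddle s) ^ (K + 1))"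
proof -
  obtain c C where c: "0 < c" "0 \<le> C"
    and R: "\<And>s t. s \<in> sector \<theta> \<Longrightarrow> norm (exp (pi * \<i> / 2 * (disp (qq s) t)\<^sup>2) * remainder K s t)
        \<le> C * exp (- (c * (norm (disp (qq s) t))\<^sup>2)) * (norm (disp (qq s) t) / norm (saddle s)) ^ (K + 1)"
    using exp_remainder_le[OF assms, of K] by metis
  define p where "p = pi / (2 * sqrt 2)"
  \<comment> \<open>The linear coefficient collects \<open>p\<close> from passing from
    \<open>|t|\<close> to \<open>|mu s|\<close> and \<open>K + 1\<close> from the power of
    \<open>W\<close>.\<close>
  define h where "h = (\<lambda>x. exp (0 + (p + real (K + 1)) * \<bar>x\<bar> - c * x\<^sup>2))"
  have h: "integrable lborel h" unfolding h_def using c(1) by (rule integrable_gauss_linear)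
  show ?thesis
  proof (rule that[of "2 * C * (LBINT x. h x)"])
    fix s assume s: "s \<in> sector \<theta>"
    define A where "A = 2 * C * exp (- p * \<bar>mu s\<bar>) / norm (saddle s) ^ (K + 1)"
    have le: "norm (gauss_kernel (qq s) t * remainder K s t * dir) \<le> A * h (t + mu s)" for t
    proof -
      define W where "W = norm (disp (qq s) t)"
      have W: "\<bar>t + mu s\<bar> \<le> W" "W \<le> 1 + \<bar>t + mu s\<bar>" "0 \<le> W"
        using norm_disp(1,2)[OF qq_Re_minus_Im[OF assms(1) s], of t] by (simp_all add: W_def mu_def)
      have "norm (gauss_kernel (qq s) t * remainder K s t * dir) = norm (gauss_kernel (qq s) t * remainder K s t)"
        by (simp add: norm_mult)
      also have "\<dots> \<le> 2 * exp (- (p * \<bar>t\<bar>)) * (C * exp (- (c * W\<^sup>2)) * (W / norm (saddle s)) ^ (K + 1))"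
        unfolding p_def W_def by (rule norm_gauss_kernel_mult_le[OF R[OF s]])
      also have "\<dots> = 2 * C / norm (saddle s) ^ (K + 1) * (exp (- (p * \<bar>t\<bar>)) * exp (- (c * W\<^sup>2)) * W ^ (K + 1))"
        by (simp add: power_divide)
      also have "\<dots> \<le> 2 * C / norm (saddle s) ^ (K + 1) *
          (exp (- p * \<bar>mu s\<bar> + p * \<bar>t + mu s\<bar>) * exp (- (c * (t + mu s)\<^sup>2)) * exp (real (K + 1) * \<bar>t + mu s\<bar>))"
      proof (intro mult_left_mono mult_mono)
        have "p * \<bar>mu s\<bar> \<le> p * (\<bar>t\<bar> + \<bar>t + mu s\<bar>)"
          by (intro mult_left_mono) (auto simp: p_def)
        thus "exp (- (p * \<bar>t\<bar>)) \<le> exp (- p * \<bar>mu s\<bar> + p * \<bar>t + mu s\<bar>)"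
          by (simp add: algebra_simps)
        have "(t + mu s)\<^sup>2 \<le> W\<^sup>2" using W by (simp add: abs_le_square_iff[symmetric])
        thus "exp (- (c * W\<^sup>2)) \<le> exp (- (c * (t + mu s)\<^sup>2))" using c(1) by simp
        show "W ^ (K + 1) \<le> exp (real (K + 1) * \<bar>t + mu s\<bar>)" using W by (intro power_le_exp_mult) auto
      qed (use c W in auto)
      also have "\<dots> = A * h (t + mu s)"
        unfolding A_def h_def by (simp add: exp_add exp_diff exp_minus field_simps)
      finally show ?thesis .
    qed
    have A0: "0 \<le> A" using c by (simp add: A_def)
    have ih: "integrable lborel (\<lambda>t. h (t + mu s))"
      using lborel_integrable_real_affine[OF h, of 1 "mu s"] by (simp add: add.commute)
    have "norm (error_term K s) \<le> (LBINT t. norm (gauss_kernel (qq s) t * remainder K s t * dir))"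
      unfolding error_term_def by (rule integral_norm_bound)
    also have "\<dots> \<le> (LBINT t. A * h (t + mu s))"
      using le A0 ih by (intro integral_mono' integrable_mult_right) (auto simp: h_def)
    also have "\<dots> = A * (LBINT t. h (t + mu s))" by simp
    also have "(LBINT t. h (t + mu s)) = (LBINT x. h x)"
      using lborel_integral_real_affine[of 1 h "mu s"] by (simp add: add.commute)
    finally show "norm (error_term K s) \<le> 2 * C * (LBINT x. h x) * (exp (- (pi / (2 * sqrt 2)) * \<bar>mu s\<bar>) / norm (saddle s) ^ (K + 1))"
      by (simp add: A_def p_def mult_ac)
  qed
qed

section \<open>Termwise integration and conclusion\<close>

lemma measurable_gauss_kernel [measurable]: "gauss_kernel q \<in> borel_measurable borel"
  unfolding gauss_kernel_def[abs_def] disp_def by measurable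

lemma measurable_gen_arg [measurable]: "gen_arg q \<in> borel_measurable borel"
  unfolding gen_arg_def[abs_def] disp_def by measurable

text \<open>Half of the Gaussian exponent survives the growth allowed by \<open>norm_PP_le\<close>;
  of the reciprocal cosine only boundedness is used.\<close>

lemma integrable_gauss_kernel_PP:
  assumes "\<bar>Re q - Im q\<bar> \<le> 1"
  shows "integrable lborel (\<lambda>t. gauss_kernel q t * PP k (gen_arg q t))"
proof -
  define \<mu> where "\<mu> = (Re q + Im q) / sqrt 2"
  define h where "h = (\<lambda>x. exp (0 + real k * \<bar>x\<bar> - pi / 4 * x\<^sup>2))"
  define A where "A = 2 * exp (pi / 2) * (8 * sqrt pi) ^ k"
  have h: "integrable lborel h" unfolding h_def by (rule integrable_gauss_linear) simp
  have "integrable lborel (\<lambda>t. h (t + \<mu>))"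
    using lborel_integrable_real_affine[OF h, of 1 \<mu>] by (simp add: add.commute)
  hence "integrable lborel (\<lambda>t. A * h (t + \<mu>))" by simp
  thus ?thesis
  proof (rule Bochner_Integration.integrable_bound)
    show "(\<lambda>t. gauss_kernel q t * PP k (gen_arg q t)) \<in> borel_measurable lborel" by measurable
    show "AE t in lborel. norm (gauss_kernel q t * PP k (gen_arg q t)) \<le> norm (A * h (t + \<mu>))"
    proof (rule AE_I2)
      fix t
      define W where "W = norm (disp q t)"
      have W: "\<bar>t + \<mu>\<bar> \<le> W" "W \<le> 1 + \<bar>t + \<mu>\<bar>" "0 \<le> W"
        using norm_disp(1,2)[OF assms, of t] by (simp_all add: W_def \<mu>_def)
      have "norm (exp (pi * \<i> / 2 * (disp q t)\<^sup>2) * PP k (gen_arg q t))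
          \<le> exp (pi / 2 - pi / 2 * W\<^sup>2) * (exp (pi / 4 * W\<^sup>2) * (8 * sqrt pi * W) ^ k)"
        unfolding norm_mult
      proof (intro mult_mono)
        show "norm (exp (pi * \<i> / 2 * (disp q t)\<^sup>2)) \<le> exp (pi / 2 - pi / 2 * W\<^sup>2)"
          unfolding W_def by (rule norm_disp(3)[OF assms])
        show "norm (PP k (gen_arg q t)) \<le> exp (pi / 4 * W\<^sup>2) * (8 * sqrt pi * W) ^ k"
          using norm_PP_le[of k "gen_arg q t"] unfolding norm_gen_arg
          by (simp add: W_def gen_arg_def norm_mult mult.assoc)
      qed auto
      from norm_gauss_kernel_mult_le[OF this]
      have "norm (gauss_kernel q t * PP k (gen_arg q t))
          \<le> 2 * exp (- (pi / (2 * sqrt 2) * \<bar>t\<bar>)) * (exp (pi / 2 - pi / 2 * W\<^sup>2) * (exp (pi / 4 * W\<^sup>2) * (8 * sqrt pi * W) ^ k))" .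
      also have "\<dots> \<le> 2 * 1 * (exp (pi / 2 - pi / 2 * W\<^sup>2) * (exp (pi / 4 * W\<^sup>2) * (8 * sqrt pi * W) ^ k))"
        using W(3) by (intro mult_right_mono mult_left_mono) auto
      also have "\<dots> = A * (exp (- (pi / 4 * W\<^sup>2)) * W ^ k)"
        unfolding A_def power_mult_distrib by (simp add: exp_diff exp_minus field_simps flip: exp_add)
      also have "\<dots> \<le> A * (exp (- (pi / 4 * (t + \<mu>)\<^sup>2)) * exp (real k * \<bar>t + \<mu>\<bar>))"
      proof (intro mult_left_mono mult_mono)
        have "(t + \<mu>)\<^sup>2 \<le> W\<^sup>2" using W by (simp add: abs_le_square_iff[symmetric])
        thus "exp (- (pi / 4 * W\<^sup>2)) \<le> exp (- (pi / 4 * (t + \<mu>)\<^sup>2))" by simp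
        show "W ^ k \<le> exp (real k * \<bar>t + \<mu>\<bar>)" using W by (intro power_le_exp_mult) auto
      qed (use W in \<open>auto simp: A_def\<close>)
      also have "\<dots> = A * h (t + \<mu>)" unfolding h_def exp_add[symmetric] by (simp add: algebra_simps)
      also have "\<dots> \<le> norm (A * h (t + \<mu>))" by simp
      finally show "norm (gauss_kernel q t * PP k (gen_arg q t)) \<le> norm (A * h (t + \<mu>))" .
    qed
  qed
qed

lemma DD_div_saddle_power:
  "DD k (qq s) / saddle s ^ k = (LBINT t. gauss_kernel (qq s) t * (PP k (gen_arg (qq s) t) * saddle_tau s ^ k) * dir)"
proof -
  have 1: "DD k (qq s) = (- (1 / (4 * sqrt pi))) ^ k * (LBINT t. gauss_kernel (qq s) t * PP k (gen_arg (qq s) t) * dir)"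
    unfolding DD_def line_integral_def gauss_kernel_def gen_arg_def disp_def by (simp add: mult_ac)
  have 2: "saddle_tau s ^ k = (- (1 / (4 * sqrt pi))) ^ k / saddle s ^ k"
    by (simp add: saddle_tau_def flip: power_divide)
  have 3: "(LBINT t. gauss_kernel (qq s) t * (PP k (gen_arg (qq s) t) * saddle_tau s ^ k) * dir)
      = saddle_tau s ^ k * (LBINT t. gauss_kernel (qq s) t * PP k (gen_arg (qq s) t) * dir)"
    by (subst integral_mult_right_zero[symmetric]) (simp only: mult_ac)
  show ?thesis unfolding 1 3 unfolding 2 by (rule times_divide_eq_left[symmetric])
qed

lemma line_integral_saddle_expansion:
  assumes "0 < \<theta>" "s \<in> sector \<theta>"
  shows "line_integral (of_real (real (ell s) + 1 / 2)) (aux_integrand s)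
    = (- 1) ^ ell s / (2 * \<i>) * saddle s powr (- s) * exp (pi * \<i> * (saddle s)\<^sup>2) *
        ((\<Sum>k = 0..K. DD k (qq s) / saddle s ^ k) + error_term K s)"
proof -
  define P where "P = (- 1) ^ ell s / (2 * \<i>) * saddle s powr (- s) * exp (pi * \<i> * (saddle s)\<^sup>2)"
  define f where "f = (\<lambda>t. aux_integrand s (of_real (real (ell s) + 1 / 2) + of_real t * dir))"
  define g where "g = (\<lambda>t. gauss_kernel (qq s) t * gen_fun (saddle_tau s) (gen_arg (qq s) t))"
  define S where "S = (\<lambda>t. \<Sum>k\<le>K. gauss_kernel (qq s) t * (PP k (gen_arg (qq s) t) * saddle_tau s ^ k) * dir)"
  have \<xi>0: "saddle s \<noteq> 0" using sector_saddle(2)[OF assms] by auto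
  have P0: "P \<noteq> 0" using \<xi>0 by (simp add: P_def)
  have fg: "f (0 + 1 / 2 * t) / 2 = P * g t" for t
    using saddle_line_integrand(3)[OF assms, of t, folded saddle_tau_def gen_arg_def]
    unfolding f_def g_def P_def by simp
  have intf: "integrable lborel f"
    unfolding f_def by (rule integrable_aux_integrand_line[of "ell s"]) auto
  \<comment> \<open>Integrability of the exact integrand carries over from \<open>x\<close> to
    \<open>v\<close> because \<open>P\<close> is nonzero; that of the remainder then follows by
    subtraction.\<close>
  from lborel_integrable_real_affine[OF this, of "1 / 2" 0]
  have "integrable lborel (\<lambda>t. f (0 + 1 / 2 * t) / 2 / P)" by (intro integrable_divide) auto
  hence intg: "integrable lborel (\<lambda>t. g t * dir)" unfolding fg using P0 by simp
  have intk: "integrable lborel (\<lambda>t. gauss_kernel (qq s) t * (PP k (gen_arg (qq s) t) * saddle_tau s ^ k) * dir)" for k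
    using integrable_gauss_kernel_PP[OF qq_Re_minus_Im[OF assms], of k] by (simp flip: mult.assoc)
  have intS: "integrable lborel S" unfolding S_def by (intro Bochner_Integration.integrable_sum intk)
  have "line_integral (of_real (real (ell s) + 1 / 2)) (aux_integrand s) = (LBINT t. f t * dir)"
    unfolding line_integral_def f_def ..
  also have "\<dots> = \<bar>1 / 2\<bar> *\<^sub>R (LBINT t. f (0 + 1 / 2 * t) * dir)"
    by (rule lborel_integral_real_affine) simp
  also have "\<dots> = (LBINT t. f (0 + 1 / 2 * t) / 2 * dir)" by (simp add: scaleR_conv_of_real)
  also have "\<dots> = P * (LBINT t. g t * dir)" unfolding fg mult.assoc by simp
  also have "(LBINT t. g t * dir) = (LBINT t. S t) + (LBINT t. g t * dir - S t)"
    using intS intg by simp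
  also have "(\<lambda>t. g t * dir - S t) = (\<lambda>t. gauss_kernel (qq s) t * remainder K s t * dir)"
    unfolding g_def S_def remainder_def by (simp add: fun_eq_iff algebra_simps sum_distrib_left sum_distrib_right)
  also have "(LBINT t. S t) = (\<Sum>k\<le>K. DD k (qq s) / saddle s ^ k)"
    unfolding S_def DD_div_saddle_power by (intro Bochner_Integration.integral_sum intk)
  finally show ?thesis unfolding P_def error_term_def by (simp add: atMost_atLeast0)
qed

text \<open>The lines through \<open>c\<close> and \<open>N + 1 / 2\<close> may come in either
  order. The second can lie to the left only for \<open>N = 0\<close>, and then both cross between 0
  and 1, so no pole is met.\<close>

lemma riemann_aux_shift:
  assumes "0 < c" "c < 1"
  shows "riemann_aux c s = (\<Sum>n = 1..N. of_nat n powr (- s)) + line_integral (of_real (real N + 1 / 2)) (aux_integrand s)"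
proof -
  consider "c < real N + 1 / 2" | "c = real N + 1 / 2" | "real N + 1 / 2 < c" by linarith
  thus ?thesis
  proof cases
    case 1
    show ?thesis
      using line_integral_shift[of 0 c N "real N + 1 / 2" s] assms 1 by (simp add: riemann_aux_eq)
  next
    case 2
    hence N: "N = 0" using assms by linarith
    hence c: "c = 1 / 2" using 2 by simp
    show ?thesis unfolding riemann_aux_eq N c by simp
  next
    case 3
    hence "N = 0" using assms by linarith
    thus ?thesis using line_integral_shift[of 0 "1 / 2" 0 c s] assms 3 \<open>N = 0\<close> by (simp add: riemann_aux_eq)
  qed
qed

theorem theorem5:
  fixes \<theta> :: real and K :: nat
  assumes "0 < \<theta>" and "\<theta> < pi" and "1 \<le> K"
  shows "\<exists>E :: complex \<Rightarrow> complex.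
    (\<lambda>s. norm (E s)) \<in> O[inf at_infinity (principal (sector \<theta>))](\<lambda>s.
      exp (- (pi / (2 * sqrt 2)) * \<bar>mu s\<bar>) / norm (saddle s) ^ (K + 1)) \<and>
    (\<forall>s\<in>sector \<theta>. \<forall>c\<in>{0<..<1}.
      riemann_aux c s =
        (\<Sum>n = 1..ell s. of_nat n powr (- s)) +
        (- 1) ^ ell s / (2 * \<i>) * saddle s powr (- s) * exp (pi * \<i> * (saddle s)\<^sup>2) *
          ((\<Sum>k = 0..K. DD k (qq s) / saddle s ^ k) + E s))"
proof (intro exI[of _ "error_term K"] conjI ballI)
  obtain C where C: "\<And>s. s \<in> sector \<theta> \<Longrightarrow>
      norm (error_term K s) \<le> C * (exp (- (pi / (2 * sqrt 2)) * \<bar>mu s\<bar>) / norm (saddle s) ^ (K + 1))"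
    using norm_error_term_le[OF assms(1,2), of K] by metis
  show "(\<lambda>s. norm (error_term K s)) \<in> O[inf at_infinity (principal (sector \<theta>))](\<lambda>s.
      exp (- (pi / (2 * sqrt 2)) * \<bar>mu s\<bar>) / norm (saddle s) ^ (K + 1))"
    using C by (intro bigoI[where c = C]) (auto simp: eventually_inf_principal)
  fix s c assume "s \<in> sector \<theta>" "c \<in> {0<..<1::real}"
  thus "riemann_aux c s =
      (\<Sum>n = 1..ell s. of_nat n powr (- s)) +
      (- 1) ^ ell s / (2 * \<i>) * saddle s powr (- s) * exp (pi * \<i> * (saddle s)\<^sup>2) *
        ((\<Sum>k = 0..K. DD k (qq s) / saddle s ^ k) + error_term K s)"
    using riemann_aux_shift[of c s "ell s"] line_integral_saddle_expansion[OF assms(1), of s K] by simp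
qed

end
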